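(* Write $U = \mathbb{R}^{\mathbb{N}}$ (with the topology of pointwise convergence). 1. Every Borel field $(W_y)_{y \in Y}$ of Polish spaces is isomorphic with a Borel field of the form $V_\gamma$ for some Borel map $\gamma : Y \to F(U)$. 2. Consider the standard Borel space $X = [0,1] \times F(U)$. The tautological Borel field $V_{\widetilde{\gamma}}$ given by $\widetilde{\gamma} : X \to F(U) : \widetilde{\gamma}(t,P) = P$ is a universal Borel field of Polish spaces.
   Context: Conventions. A standard Borel space is a measurable space isomorphic to a Borel subset of a Polish space. Product spaces carry the product $\sigma$-algebra and subsets the restricted $\sigma$-algebra. For a family of sets $V = (V_x)_{x\in X}$, the symbol $V$ also denotes the disjoint union of the $V_x$, and $\pi : V \to X$ is the map with $\pi(v) = x$ for $v \in V_x$. $V \times_\pi V = \{(v,w) \in V \times V \mid \pi(v)=\pi(w)\}$. A section is a map $\varphi : X \to V$ with $\varphi(x)\in V_x$ for all $x$. A sequence of Borel sections $\varphi_n : X \to V$ is dense if $\{\varphi_n(x) \mid n\in\mathbb{N}\}$ is dense in $V_x$ for every $x\in X$. A Borel field of Polish spaces consists of a standard Borel space $X$, a family $V=(V_x)_{x\in X}$ of Polish spaces and a standard Borel structure on $V$ such that: (1) $\pi : V\to X$ is Borel; (2) there is a Borel map $d : V\times_\pi V\to[0,+\infty)$ whose restriction to each $V_x\times V_x$ is a separable complete metric inducing the topology of $V_x$; (3) there is a dense sequence of Borel sections $X\to V$. For a Polish space $U$, $F(U)$ is the set of nonempty closed subsets of $U$ with the Effros Borel structure, i.e. the smallest $\sigma$-algebra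 for which $\{K\in F(U)\mid K\cap\mathcal{O}\neq\emptyset\}$ is measurable for every open $\mathcal{O}\subset U$; this is a standard Borel space. For a standard Borel space $Y$ and a Borel map $\gamma : Y\to F(U)$, $V_\gamma=(\gamma(y))_{y\in Y}$ is the Borel field of Polish spaces whose standard Borel structure is given by viewing $V_\gamma=\{(y,u)\mid u\in\gamma(y)\}$ as a Borel subset of $Y\times U$. Two Borel fields $V=(V_x)_{x\in X}$ and $W=(W_y)_{y\in Y}$ of Polish spaces are isomorphic if there are bijective Borel maps $\psi : X\to Y$ and $\theta : V\to W$ such that $\pi\circ\theta=\psi\circ\pi$ and for every $x\in X$ the restriction $\theta_x : V_x\to W_{\psi(x)}$ is a homeomorphism. A Borel field $V=(V_x)_{x\in X}$ of Polish spaces is universal if every Borel field of Polish spaces is isomorphic with $(V_x)_{x\in X_0}$ for some Borel set $X_0\subset X$. *)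

theory Defs
  imports "HOL-Analysis.Analysis"
begin

text \<open>
  Measurable spaces are rendered by the type of measures; only \<^const>\<open>space\<close> and \<^const>\<open>sets\<close>
  are ever used, the measure itself is irrelevant.
\<close>

definition Polish_space :: "'a topology \<Rightarrow> bool" where
  "Polish_space T \<longleftrightarrow> completely_metrizable_space T \<and> separable_space T"

definition borel_of_topology :: "'a topology \<Rightarrow> 'a measure" where
  "borel_of_topology T = sigma (topspace T) {G. openin T G}"

definition Borel_isomorphic :: "'a measure \<Rightarrow> 'b measure \<Rightarrow> bool" where
  "Borel_isomorphic M N \<longleftrightarrow>
     (\<exists>f g. f \<in> measurable M N \<and> g \<in> measurable N M \<and>
        (\<forall>x\<in>space M. g (f x) = x) \<and> (\<forall>y\<in>space N. f (g y) = y))"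

text \<open>
  A Polish space has at most the cardinality of the continuum, so it is homeomorphic to a Polish
  space whose underlying set is a set of reals (with a topology unrelated to the usual one).
  Hence quantifying over topologies of type \<^typ>\<open>real topology\<close> covers all Polish spaces.
\<close>

definition standard_Borel :: "'a measure \<Rightarrow> bool" where
  "standard_Borel M \<longleftrightarrow>
     (\<exists>(P :: real topology) B. Polish_space P \<and> B \<in> sets (borel_of_topology P) \<and>
        Borel_isomorphic M (restrict_space (borel_of_topology P) B))"

text \<open>
  The data of a field: the base space $X$, the topological spaces $V_x$ (only those with $x$ in
  the space of \<open>base\<close> matter), and the measurable space on the disjoint union of the $V_x$, which is
  realised as the set of pairs $(x,v)$ with $v \in V_x$, so that $\pi$ is \<^const>\<open>fst\<close>.
\<close>

record ('x, 'v) field_of_spaces =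
  base :: "'x measure"
  fibre :: "'x \<Rightarrow> 'v topology"
  total :: "('x \<times> 'v) measure"

text \<open>
  The metric is only relevant on pairs of points over the same base point. \<^locale>\<open>Metric_space\<close>
  also asks for symmetry and nonnegativity outside the carrier; as the metric is existentially
  quantified, it can be taken to vanish there.
\<close>

definition Borel_field :: "('x, 'v) field_of_spaces \<Rightarrow> bool" where
  "Borel_field V \<longleftrightarrow>
     standard_Borel (base V) \<and>
     (\<forall>x\<in>space (base V). Polish_space (fibre V x)) \<and>
     standard_Borel (total V) \<and>
     space (total V) = (SIGMA x:space (base V). topspace (fibre V x)) \<and>
     fst \<in> measurable (total V) (base V) \<and>
     (\<exists>d :: 'x \<times> 'v \<Rightarrow> 'x \<times> 'v \<Rightarrow> real.
        (\<lambda>(v, w). d v w)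
          \<in> borel_measurable (restrict_space (total V \<Otimes>\<^sub>M total V) {(v, w). fst v = fst w}) \<and>
        (\<forall>x\<in>space (base V).
           let S = topspace (fibre V x); dx = (\<lambda>v w. d (x, v) (x, w)) in
             Metric_space S dx \<and> Metric_space.mcomplete S dx \<and>
             separable_space (Metric_space.mtopology S dx) \<and>
             Metric_space.mtopology S dx = fibre V x)) \<and>
     (\<exists>\<phi> :: nat \<Rightarrow> 'x \<Rightarrow> 'x \<times> 'v.
        (\<forall>n. \<phi> n \<in> measurable (base V) (total V)) \<and>
        (\<forall>n. \<forall>x\<in>space (base V). fst (\<phi> n x) = x) \<and>
        (\<forall>x\<in>space (base V).
           fibre V x closure_of (range (\<lambda>n. snd (\<phi> n x))) = topspace (fibre V x)))"

definition restrict_field ::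
    "('x, 'v) field_of_spaces \<Rightarrow> 'x set \<Rightarrow> ('x, 'v) field_of_spaces" where
  "restrict_field V X\<^sub>0 =
     \<lparr>base = restrict_space (base V) X\<^sub>0, fibre = fibre V,
      total = restrict_space (total V) {v. fst v \<in> X\<^sub>0}\<rparr>"

text \<open>The inverses of \<open>\<psi>\<close> and \<open>\<theta>\<close> are deliberately not required to be Borel.\<close>

definition isomorphic_Borel_fields ::
    "('x, 'v) field_of_spaces \<Rightarrow> ('y, 'w) field_of_spaces \<Rightarrow> bool" where
  "isomorphic_Borel_fields V W \<longleftrightarrow>
     Borel_field V \<and> Borel_field W \<and>
     (\<exists>\<psi> \<theta>. \<psi> \<in> measurable (base V) (base W) \<and>
        bij_betw \<psi> (space (base V)) (space (base W)) \<and>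
        \<theta> \<in> measurable (total V) (total W) \<and>
        bij_betw \<theta> (space (total V)) (space (total W)) \<and>
        (\<forall>v\<in>space (total V). fst (\<theta> v) = \<psi> (fst v)) \<and>
        (\<forall>x\<in>space (base V).
           homeomorphic_map (fibre V x) (fibre W (\<psi> x)) (\<lambda>v. snd (\<theta> (x, v)))))"

text \<open>
  Universality quantifies over all Borel fields, of whatever types; the type arguments name the
  types of base points and of points of the fibres of the fields being tested.
\<close>

definition universal_Borel_field ::
    "'y itself \<Rightarrow> 'w itself \<Rightarrow> ('x, 'v) field_of_spaces \<Rightarrow> bool" where
  "universal_Borel_field _ _ V \<longleftrightarrow>
     Borel_field V \<and>
     (\<forall>W :: ('y, 'w) field_of_spaces. Borel_field W \<longrightarrow>
        (\<exists>X\<^sub>0\<in>sets (base V). isomorphic_Borel_fields W (restrict_field V X\<^sub>0)))"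

definition Effros :: "'u::polish_space set measure" where
  "Effros = sigma {K. closed K \<and> K \<noteq> {}}
     {{K. closed K \<and> K \<noteq> {} \<and> K \<inter> G \<noteq> {}} | G. open G}"

definition closed_sets_field ::
    "'y measure \<Rightarrow> ('y \<Rightarrow> 'u::polish_space set) \<Rightarrow> ('y, 'u) field_of_spaces" where
  "closed_sets_field Y \<gamma> =
     \<lparr>base = Y, fibre = (\<lambda>y. top_of_set (\<gamma> y)),
      total = restrict_space (Y \<Otimes>\<^sub>M borel) {(y, u). u \<in> \<gamma> y}\<rparr>"

end

theory Submission
  imports Defs
begin

text \<open>
  A complete metric space with a dense sequence \<open>p\<close> embeds as a closed subset of the sequence space
  via the functions \<open>v \<mapsto> d v (p n)\<close> together with
  \<open>v \<mapsto> 1 / (\<Sum>n. 2\<^bsup>-n\<^esup> * max 0 (1/m - d v (p n)))\<close>: if the latter are bounded along a sequence of points,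
  then for every \<open>m\<close> finitely many balls of radius \<open>1/m\<close> around points \<open>p n\<close> contain the sequence.
  Applied fibrewise to the metric and the sections of a Borel field, this formula is Borel, and the
  images of the fibres form an Effros measurable family because the sections are dense.

  A Borel sequence \<open>\<sigma>\<close> of selectors that is dense in every closed set makes the Effros space a Borel
  retract of a space of sequences, via \<open>K \<mapsto> (\<sigma> n K)\<^sub>n\<close> and \<open>z \<mapsto> closure (range z)\<close>. Hence it is
  standard Borel, and the tautological field is a Borel field.
\<close>

subsection \<open>Closed embeddings into the sequence space\<close>

text \<open>Distances to a dense sequence alone embed a complete metric space, but in general not
  onto a closed set: in an infinite countable discrete space with distances 0 and 1, the distance
  sequences of distinct points converge coordinatewise to the constant 1, which no point attains.
  Completeness helps only once the points form a Cauchy sequence, so extra coordinates have to blow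
  up along every sequence that leaves all finite unions of balls of some fixed radius around the
  points \<open>p n\<close>. Along such a sequence the weight tends to 0 and its reciprocal to
  infinity. Both depend on the distance sequence only, so one Borel map on the sequence space serves
  all fibres at once. Applied to a single Polish space, the same map also brings abstract standard
  Borel spaces into the sequence space and from there into the unit interval. Apart from the closed
  images of this code, every Borel image that occurs is the range of a map with a Borel left
  inverse, and can therefore be described by a Borel condition.\<close>

definition covering_weight :: "real \<Rightarrow> (nat \<Rightarrow> real) \<Rightarrow> real" where
  "covering_weight c r = (\<Sum>n. (1/2) ^ n * max 0 (c - \<bar>r n\<bar>))"

text \<open>Distances and reciprocals are interleaved, the reciprocals at the radii
  \<open>1 / Suc m\<close>. The convention \<open>inverse 0 = 0\<close> makes the map total; for
  distances to a dense sequence all weights are positive, so it is not met there.\<close>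

definition closed_code :: "(nat \<Rightarrow> real) \<Rightarrow> nat \<Rightarrow> real" where
  "closed_code r i =
     (if even i then r (i div 2) else inverse (covering_weight (1 / Suc (i div 2)) r))"

lemma covering_weight_summable:
  fixes c :: real
  assumes "c \<ge> 0"
  shows "summable (\<lambda>n. (1/2) ^ n * max 0 (c - \<bar>r n\<bar>))"
proof (rule summable_comparison_test')
  show "summable (\<lambda>n. (1/2::real) ^ n * c)"
    by (intro summable_mult2 summable_geometric) auto
  show "norm ((1/2) ^ n * max 0 (c - \<bar>r n\<bar>)) \<le> (1/2) ^ n * c" if "n \<ge> 0" for n
    using assms by (auto simp: abs_mult intro!: mult_left_mono)
qed

text \<open>The bound \<open>(1/2) ^ n * c\<close> on the terms is independent of \<open>r\<close>,
  thanks to the absolute value also for negative entries, and each partial sum sees only finitely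
  many coordinates.\<close>

lemma continuous_on_covering_weight:
  assumes "c \<ge> 0"
  shows "continuous_on UNIV (covering_weight c)"
proof -
  have "uniform_limit UNIV (\<lambda>n r. \<Sum>i<n. (1/2) ^ i * max 0 (c - \<bar>r i\<bar>))
      (\<lambda>r. \<Sum>i. (1/2) ^ i * max 0 (c - \<bar>r i\<bar>)) sequentially"
  proof (rule Weierstrass_m_test)
    show "summable (\<lambda>n. (1/2::real) ^ n * c)"
      by (intro summable_mult2 summable_geometric) auto
    show "norm ((1/2) ^ n * max 0 (c - \<bar>r n\<bar>)) \<le> (1/2) ^ n * c" for n and r :: "nat \<Rightarrow> real"
      using assms by (auto simp: abs_mult intro!: mult_left_mono)
  qed
  then have "continuous_on UNIV (\<lambda>r. \<Sum>i. (1/2) ^ i * max 0 (c - \<bar>r i\<bar>))"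
    by (rule uniform_limit_theorem[rotated])
      (auto intro!: always_eventually continuous_intros continuous_on_product_coordinates)
  then show ?thesis
    by (simp add: covering_weight_def[abs_def])
qed

lemma covering_weight_pos:
  assumes "\<bar>r n\<bar> < c"
  shows "covering_weight c r > 0"
  unfolding covering_weight_def
  using assms by (intro suminf_pos2[where i = n] covering_weight_summable) auto

text \<open>The terms from index \<open>N\<close> on add up to at most
  \<open>(1/2) ^ N * (2 * c)\<close>, so a weight of at least \<open>e\<close> needs a nonzero term
  before \<open>N\<close>. This \<open>N\<close> is the same for all \<open>r\<close>, which later
  yields one finite cover for a whole sequence of points.\<close>

lemma covering_weight_large:
  assumes "c > 0" "e > 0"
  obtains N where "\<And>r. e \<le> covering_weight c r \<Longrightarrow> \<exists>n<N. \<bar>r n\<bar> < c"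
proof -
  have "\<forall>\<^sub>F N in sequentially. (1/2) ^ N * (2 * c) < e"
    by (rule order_tendstoD(2)[where y = 0])
      (use assms in \<open>auto intro!: tendsto_mult_left_zero LIMSEQ_power_zero\<close>)
  then obtain N where N: "(1/2) ^ N * (2 * c) < e"
    by (auto simp: eventually_sequentially)
  have "\<exists>n<N. \<bar>r n\<bar> < c" if large: "e \<le> covering_weight c r" for r
  proof (rule ccontr)
    assume neg: "\<not> (\<exists>n<N. \<bar>r n\<bar> < c)"
    define t where "t = (\<lambda>n. (1/2) ^ n * max 0 (c - \<bar>r n\<bar>))"
    have t: "summable t"
      unfolding t_def using assms by (intro covering_weight_summable) simp
    have geo: "(\<lambda>n. (1/2) ^ n * ((1/2) ^ N * c)) sums (2 * ((1/2) ^ N * c))"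
      using geometric_sums[of "1/2::real"] by (intro sums_mult2) simp
    have "covering_weight c r = (\<Sum>n. t (n + N)) + (\<Sum>n<N. t n)"
      unfolding covering_weight_def t_def[symmetric] using suminf_split_initial_segment[OF t] .
    also have "(\<Sum>n<N. t n) = 0"
      using neg by (intro sum.neutral) (force simp: t_def)
    also have "(\<Sum>n. t (n + N)) \<le> (\<Sum>n. (1/2) ^ n * ((1/2) ^ N * c))"
    proof (rule suminf_le)
      show "t (n + N) \<le> (1/2) ^ n * ((1/2) ^ N * c)" for n
        using assms by (auto simp: t_def power_add mult.assoc intro!: mult_left_mono)
      show "summable (\<lambda>n. t (n + N))"
        using t by (simp add: summable_iff_shift)
    qed (rule sums_summable[OF geo])
    also have "\<dots> = (1/2) ^ N * (2 * c)"
      using sums_unique[OF geo] by simp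
    finally show False
      using N large by simp
  qed
  then show ?thesis
    by (rule that)
qed

text \<open>Discontinuity where a weight vanishes is harmless: \<open>inverse\<close> with
  \<open>inverse 0 = 0\<close> is Borel on the whole line.\<close>

lemma measurable_closed_code [measurable]: "closed_code \<in> borel_measurable borel"
proof (rule measurable_coordinatewise_then_product)
  fix i
  have "covering_weight (1 / Suc (i div 2)) \<in> borel_measurable borel"
    by (intro borel_measurable_continuous_onI continuous_on_covering_weight) simp
  moreover have "(\<lambda>r::nat \<Rightarrow> real. r (i div 2)) \<in> borel_measurable borel"
    by (rule measurable_product_coordinates)
  ultimately show "(\<lambda>r. closed_code r i) \<in> borel_measurable borel"
    by (cases "even i") (simp_all add: closed_code_def)
qed

context Metric_space
begin

lemma dense_sequence_approx:
  assumes "mtopology closure_of range p = M" "v \<in> M" "e > 0"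
  obtains n where "p n \<in> M" "d v (p n) < e"
  using assms by (force simp: metric_closure_of)

text \<open>Distance functions are 1-Lipschitz, so only the reciprocals could fail to be continuous.
  Density of \<open>p\<close> puts some \<open>p n\<close> within every radius of \<open>v\<close>
  and thereby keeps all weights positive.\<close>

lemma continuous_map_closed_code:
  assumes dense: "mtopology closure_of range p = M" and p: "range p \<subseteq> M"
  shows "continuous_map mtopology euclidean (\<lambda>v. closed_code (\<lambda>n. d v (p n)))"
proof -
  have "continuous_map mtopology euclidean (\<lambda>v. d v (p n))" for n
    unfolding metric_continuous_map[OF Met_TC.Metric_space_axioms, unfolded mtopology_is_euclidean]
  proof (intro conjI ballI allI impI)
    fix a and e :: real
    assume "a \<in> M" "e > 0"
    then show "\<exists>\<delta>>0. \<forall>x. x \<in> M \<and> d a x < \<delta> \<longrightarrow> dist (d a (p n)) (d x (p n)) < e"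
      using p by (intro exI[of _ e])
        (smt (verit) commute dist_real_def range_subsetD triangle)
  qed simp
  then have "continuous_map mtopology (product_topology (\<lambda>i. euclidean) UNIV) (\<lambda>v n. d v (p n))"
    by (simp add: continuous_map_componentwise_UNIV)
  then have D: "continuous_map mtopology euclidean (\<lambda>v n. d v (p n))"
    by (simp add: euclidean_product_topology)
  define Q where "Q = {r. \<forall>c>0. covering_weight c r \<noteq> 0}"
  have "continuous_on Q (\<lambda>r. closed_code r i)" for i
  proof (cases "even i")
    case True
    then show ?thesis
      using continuous_on_subset[OF continuous_on_product_coordinates] by (simp add: closed_code_def)
  next
    case False
    have "continuous_on Q (\<lambda>r. inverse (covering_weight (1 / Suc (i div 2)) r))"
      by (intro continuous_on_inverse continuous_on_subset[OF continuous_on_covering_weight])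
        (auto simp: Q_def)
    with False show ?thesis
      by (simp add: closed_code_def)
  qed
  then have code: "continuous_on Q closed_code"
    by (rule continuous_on_coordinatewise_then_product)
  have "(\<lambda>n. d v (p n)) \<in> Q" if "v \<in> M" for v
  proof -
    have "covering_weight c (\<lambda>n. d v (p n)) > 0" if "c > 0" for c
      using dense_sequence_approx[OF dense \<open>v \<in> M\<close> that]
        covering_weight_pos[of "\<lambda>n. d v (p n)"] by (metis abs_of_nonneg nonneg)
    then show ?thesis
      by (force simp: Q_def)
  qed
  with D have "continuous_map mtopology (top_of_set Q) (\<lambda>v n. d v (p n))"
    by (auto simp: continuous_map_in_subtopology)
  moreover have "continuous_map (top_of_set Q) euclidean closed_code"
    using code by simp
  ultimately have "continuous_map mtopology euclidean (closed_code \<circ> (\<lambda>v n. d v (p n)))"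
    by (rule continuous_map_compose)
  then show ?thesis
    by (simp add: o_def)
qed

text \<open>The even coordinates suffice: a point \<open>p n\<close> closer to \<open>v\<close> than
  half of \<open>d v w\<close> cannot have the same distance to \<open>w\<close>.\<close>

lemma closed_code_separates:
  assumes dense: "mtopology closure_of range p = M"
    and v: "v \<in> M" and w: "w \<in> M"
    and eq: "closed_code (\<lambda>n. d v (p n)) = closed_code (\<lambda>n. d w (p n))"
  shows "v = w"
proof (rule ccontr)
  assume "v \<noteq> w"
  then have "d v w / 2 > 0"
    using v w by simp
  then obtain n where n: "p n \<in> M" "d v (p n) < d v w / 2"
    using dense_sequence_approx[OF dense v] by metis
  have "d v (p n) = d w (p n)"
    using fun_cong[OF eq, of "2 * n"] by (simp add: closed_code_def)
  then show False
    using n triangle[of v "p n" w] v w by (simp add: commute)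
qed

text \<open>
  Bounded odd coordinates make a sequence totally bounded, and the convergence of the even ones then
  makes it a Cauchy sequence.
\<close>

lemma closed_code_convergent_imp_MCauchy:
  assumes p: "range p \<subseteq> M" and v: "range v \<subseteq> M"
    and lim: "\<And>i. convergent (\<lambda>k. closed_code (\<lambda>n. d (v k) (p n)) i)"
    and dense: "mtopology closure_of range p = M"
  shows "MCauchy v"
  unfolding MCauchy_def
proof (intro conjI allI impI)
  show "range v \<subseteq> M" by fact
  fix e :: real
  assume "e > 0"
  \<comment> \<open>The final estimate is \<open>3 * c\<close>, so a radius \<open>c\<close> below
    \<open>e / 4\<close> leaves room.\<close>
  then obtain m where m: "1 / real (Suc m) < e / 4"
    by (metis nat_approx_posE zero_less_divide_iff zero_less_numeral)
  define c where "c = 1 / real (Suc m)"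
  have "c > 0" by (simp add: c_def)
  define s where "s = (\<lambda>k. covering_weight c (\<lambda>n. d (v k) (p n)))"
  have s_pos: "s k > 0" for k
    unfolding s_def using dense_sequence_approx[OF dense _ \<open>c > 0\<close>, of "v k"] v
    by (metis abs_of_nonneg covering_weight_pos nonneg rangeI subsetD)
  \<comment> \<open>Coordinate \<open>2 * m + 1\<close> is the reciprocal at radius
    \<open>1 / Suc m\<close>. Being convergent it is bounded, which keeps \<open>s k\<close> away
    from 0.\<close>
  have "convergent (\<lambda>k. inverse (s k))"
    using lim[of "2 * m + 1"] by (simp add: closed_code_def s_def c_def)
  then obtain b where "b > 0" and b: "\<And>k. norm (inverse (s k)) \<le> b"
    by (meson BseqE convergent_imp_Bseq)
  have "inverse b \<le> s k" for k
    using b[of k] s_pos[of k] \<open>b > 0\<close>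
    by (metis abs_of_pos inverse_inverse_eq inverse_positive_iff_positive le_imp_inverse_le real_norm_def)
  \<comment> \<open>One \<open>N\<close> serves all \<open>k\<close>: finitely many balls of radius
    \<open>c\<close> cover the whole sequence.\<close>
  then obtain N where N: "\<exists>n<N. d (v k) (p n) < c" for k
    using covering_weight_large[of c "inverse b"] \<open>c > 0\<close> \<open>b > 0\<close>
    unfolding s_def by (metis abs_of_nonneg inverse_positive_iff_positive nonneg)
  have "Cauchy (\<lambda>k. d (v k) (p n))" for n
    using lim[of "2 * n"] by (simp add: closed_code_def convergent_Cauchy)
  then have "\<exists>K. \<forall>k\<ge>K. \<forall>l\<ge>K. dist (d (v k) (p n)) (d (v l) (p n)) < c" for n
    using \<open>c > 0\<close> by (simp add: Cauchy_def)
  then obtain K where K: "\<And>n k l. k \<ge> K n \<Longrightarrow> l \<ge> K n \<Longrightarrow> dist (d (v k) (p n)) (d (v l) (p n)) < c"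
    by metis
  show "\<exists>K. \<forall>k l. K \<le> k \<longrightarrow> K \<le> l \<longrightarrow> d (v k) (v l) < e"
  proof (intro exI allI impI)
    fix k l
    assume k: "Max (K ` {..<N}) \<le> k" and l: "Max (K ` {..<N}) \<le> l"
    \<comment> \<open>The centre \<open>p n\<close> is chosen for \<open>v k\<close>;
      \<open>v l\<close> lies within \<open>2 * c\<close> of it because the distances to
      \<open>p n\<close> have settled up to \<open>c\<close>.\<close>
    obtain n where n: "n < N" "d (v k) (p n) < c"
      using N by blast
    then have "K n \<le> Max (K ` {..<N})"
      by simp
    then have "K n \<le> k" "K n \<le> l"
      using k l by linarith+
    then have "dist (d (v k) (p n)) (d (v l) (p n)) < c"
      by (rule K)
    then have "d (v l) (p n) < 2 * c"
      using n(2) by (simp add: dist_real_def)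
    then have "d (v k) (v l) < 3 * c"
      using n(2) triangle[of "v k" "p n" "v l"] p v
      by (smt (verit, best) commute rangeI subsetD)
    also have "\<dots> < e"
      using m \<open>c > 0\<close> unfolding c_def by linarith
    finally show "d (v k) (v l) < e" .
  qed
qed

text \<open>Coordinatewise convergence of the codes makes the preimages Cauchy, and completeness
  supplies their limit. All closed \<open>C\<close> are treated, not only the whole space, because
  this makes the code a closed map.\<close>

lemma closed_image_closed_code:
  assumes mcomplete and p: "range p \<subseteq> M" and dense: "mtopology closure_of range p = M"
    and C: "closedin mtopology C"
  shows "closed ((\<lambda>v. closed_code (\<lambda>n. d v (p n))) ` C)"
    (is "closed (?F ` C)")
  unfolding closed_sequential_limits
proof (intro allI impI, elim conjE)
  fix x l
  assume x: "\<forall>k. x k \<in> ?F ` C" and l: "x \<longlonglongrightarrow> l"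
  then obtain v where v: "\<And>k. v k \<in> C" "\<And>k. x k = ?F (v k)"
    unfolding image_iff by metis
  have vM: "range v \<subseteq> M"
    using v(1) closedin_subset[OF C] by auto
  have "MCauchy v"
  proof (rule closed_code_convergent_imp_MCauchy[OF p vM _ dense])
    fix i
    have "continuous_on UNIV (\<lambda>x::nat \<Rightarrow> real. x i)"
      by (rule continuous_on_product_coordinates)
    then have "(\<lambda>k. x k i) \<longlonglongrightarrow> l i"
      using continuous_on_tendsto_compose[OF _ l, of UNIV "\<lambda>x. x i"] by simp
    then show "convergent (\<lambda>k. ?F (v k) i)"
      unfolding v(2) convergent_def by blast
  qed
  then obtain w where w: "limitin mtopology v w sequentially"
    using \<open>mcomplete\<close> by (auto simp: mcomplete_def)
  have "w \<in> C"
    using limitin_closedin[OF w C] v(1) by simp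
  have "x = ?F \<circ> v"
    using v(2) by auto
  then have "x \<longlonglongrightarrow> ?F w"
    using continuous_map_limit[OF continuous_map_closed_code[OF dense p] w] by simp
  then have "l = ?F w"
    using l LIMSEQ_unique by blast
  then show "l \<in> ?F ` C"
    using \<open>w \<in> C\<close> by blast
qed

text \<open>A continuous injective closed map is a homeomorphism onto its image, so the inverse
  needs no estimate of its own.\<close>

lemma homeomorphic_map_closed_code:
  assumes mcomplete and p: "range p \<subseteq> M" and dense: "mtopology closure_of range p = M"
  shows "homeomorphic_map mtopology
           (top_of_set ((\<lambda>v. closed_code (\<lambda>n. d v (p n))) ` M)) (\<lambda>v. closed_code (\<lambda>n. d v (p n)))"
    (is "homeomorphic_map _ (top_of_set (?F ` M)) ?F")
proof (rule bijective_closed_imp_homeomorphic_map)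
  show "continuous_map mtopology (top_of_set (?F ` M)) ?F"
    using continuous_map_closed_code[OF dense p] by (auto simp: continuous_map_in_subtopology)
  show "closed_map mtopology (top_of_set (?F ` M)) ?F"
    unfolding closed_map_def
    using closed_image_closed_code[OF assms] closedin_subset[of mtopology]
    by (auto intro!: closed_subset)
  show "?F ` topspace mtopology = topspace (top_of_set (?F ` M))"
    by simp
  show "inj_on ?F (topspace mtopology)"
    using closed_code_separates[OF dense] by (auto intro!: inj_onI)
qed

end

subsection \<open>Standard Borel spaces\<close>

lemma Borel_isomorphicI:
  assumes "f \<in> measurable M N" "g \<in> measurable N M"
    "\<And>x. x \<in> space M \<Longrightarrow> g (f x) = x" "\<And>y. y \<in> space N \<Longrightarrow> f (g y) = y"
  shows "Borel_isomorphic M N"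
  using assms unfolding Borel_isomorphic_def by blast

lemma Borel_isomorphic_trans:
  assumes "Borel_isomorphic L M" "Borel_isomorphic M N"
  shows "Borel_isomorphic L N"
proof -
  obtain f g where fg: "f \<in> measurable L M" "g \<in> measurable M L"
    "\<forall>x\<in>space L. g (f x) = x" "\<forall>y\<in>space M. f (g y) = y"
    using assms(1) unfolding Borel_isomorphic_def by blast
  obtain h k where hk: "h \<in> measurable M N" "k \<in> measurable N M"
    "\<forall>x\<in>space M. k (h x) = x" "\<forall>y\<in>space N. h (k y) = y"
    using assms(2) unfolding Borel_isomorphic_def by blast
  show ?thesis
    by (rule Borel_isomorphicI[of "h \<circ> f" _ _ "g \<circ> k"])
      (use fg hk in \<open>auto intro: measurable_comp dest: measurable_space\<close>)
qed

lemma Borel_isomorphic_sets_eq: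
  assumes "sets M = sets N"
  shows "Borel_isomorphic M N"
  using assms sets_eq_imp_space_eq[OF assms]
  by (intro Borel_isomorphicI[of "\<lambda>x. x" _ _ "\<lambda>x. x"] measurable_ident_sets) auto

lemma Borel_isomorphic_restrict_space:
  assumes "Borel_isomorphic M N" "A \<in> sets M"
  obtains B where "B \<in> sets N" "Borel_isomorphic (restrict_space M A) (restrict_space N B)"
proof -
  obtain f g where fg: "f \<in> measurable M N" "g \<in> measurable N M"
    "\<forall>x\<in>space M. g (f x) = x" "\<forall>y\<in>space N. f (g y) = y"
    using assms(1) unfolding Borel_isomorphic_def by blast
  define B where "B = g -` A \<inter> space N"
  have "f \<in> measurable (restrict_space M A) (restrict_space N B)"
    using fg by (intro measurable_restrict_space2 measurable_restrict_space1)
      (auto simp: B_def space_restrict_space dest: measurable_space)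
  moreover have "g \<in> measurable (restrict_space N B) (restrict_space M A)"
    using fg by (intro measurable_restrict_space2 measurable_restrict_space1)
      (auto simp: B_def space_restrict_space)
  ultimately have "Borel_isomorphic (restrict_space M A) (restrict_space N B)"
    by (rule Borel_isomorphicI) (use fg in \<open>auto simp: space_restrict_space\<close>)
  moreover have "B \<in> sets N"
    unfolding B_def using fg assms by (intro measurable_sets)
  ultimately show ?thesis
    using that by blast
qed

text \<open>The range of a section \<open>f\<close> with left inverse \<open>g\<close> consists of
  the solutions of \<open>f (g z) = z\<close>. An equation takes the place of an image.\<close>

lemma Borel_isomorphic_retract:
  assumes f: "f \<in> measurable M N" and g: "g \<in> measurable N M"
    and gf: "\<And>x. x \<in> space M \<Longrightarrow> g (f x) = x"
  shows "Borel_isomorphic M (restrict_space N {z \<in> space N. f (g z) = z})"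
proof (rule Borel_isomorphicI)
  show "f \<in> measurable M (restrict_space N {z \<in> space N. f (g z) = z})"
    using f gf by (intro measurable_restrict_space2) (auto dest: measurable_space)
  show "g \<in> measurable (restrict_space N {z \<in> space N. f (g z) = z}) M"
    using g by (rule measurable_restrict_space1)
qed (use gf in \<open>auto simp: space_restrict_space\<close>)

lemma standard_Borel_isomorphic:
  "Borel_isomorphic M N \<Longrightarrow> standard_Borel N \<Longrightarrow> standard_Borel M"
  unfolding standard_Borel_def by (meson Borel_isomorphic_trans)

lemma standard_Borel_sets_cong:
  "sets M = sets N \<Longrightarrow> standard_Borel M \<longleftrightarrow> standard_Borel N"
  by (metis Borel_isomorphic_sets_eq standard_Borel_isomorphic)

lemma standard_Borel_restrict_space:
  assumes "standard_Borel M" "A \<in> sets M"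
  shows "standard_Borel (restrict_space M A)"
proof -
  obtain P :: "real topology" and B where PB: "Polish_space P" "B \<in> sets (borel_of_topology P)"
    "Borel_isomorphic M (restrict_space (borel_of_topology P) B)"
    using assms(1) unfolding standard_Borel_def by blast
  obtain C where C: "C \<in> sets (restrict_space (borel_of_topology P) B)"
    "Borel_isomorphic (restrict_space M A)
       (restrict_space (restrict_space (borel_of_topology P) B) C)"
    using Borel_isomorphic_restrict_space[OF PB(3) assms(2)] .
  have "B \<inter> C \<in> sets (borel_of_topology P)"
    using C(1) PB(2) by (subst (asm) sets_restrict_space_iff) auto
  moreover have "Borel_isomorphic (restrict_space M A) (restrict_space (borel_of_topology P) (B \<inter> C))"
    using C(2) Borel_isomorphic_sets_eq[OF sets_restrict_restrict_space]
    by (rule Borel_isomorphic_trans)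
  ultimately show ?thesis
    using PB(1) unfolding standard_Borel_def by blast
qed

section \<open>The real line and the space of real sequences as standard Borel spaces\<close>

lemma borel_of_topology_euclidean: "borel_of_topology euclidean = borel"
  by (simp add: borel_of_topology_def borel_def)

lemma second_countable_euclidean:
  "second_countable (euclidean :: 'a::second_countable_topology topology)"
proof -
  obtain B :: "'a set set" where "countable B" "\<And>C. C \<in> B \<Longrightarrow> open C"
    "\<And>S. open S \<Longrightarrow> \<exists>U. U \<subseteq> B \<and> S = \<Union>U"
    using univ_second_countable by blast
  then show ?thesis
    unfolding second_countable_def open_openin[symmetric]
    by (intro exI[of _ B]) (metis Union_iff Union_upper subset_iff)
qed

lemma standard_Borel_real: "standard_Borel (borel :: real measure)"
proof -
  have "completely_metrizable_space (euclidean :: real topology)"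
    by (rule completely_metrizable_space_euclidean)
  moreover have "separable_space (euclidean :: real topology)"
    by (intro second_countable_imp_separable_space second_countable_euclidean)
  ultimately have "Polish_space (euclidean :: real topology)"
    by (simp add: Polish_space_def)
  moreover have "Borel_isomorphic (borel :: real measure) (restrict_space (borel_of_topology (euclidean :: real topology)) UNIV)"
    by (rule Borel_isomorphic_sets_eq) (simp add: borel_of_topology_euclidean)
  ultimately show ?thesis
    unfolding standard_Borel_def
    by (intro exI[of _ euclidean] exI[of _ UNIV]) (simp add: borel_of_topology_euclidean)
qed

text \<open>Digits 0 and 1 in base 4: all later digits together contribute at most a third of a unit
  of the current place, so, unlike in base 2, no two bit sequences share a code.\<close>

definition binary_code :: "(nat \<Rightarrow> bool) \<Rightarrow> real" where
  "binary_code b = (\<Sum>n. of_bool (b n) * (1/4) ^ Suc n)"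

lemma binary_code_summable: "summable (\<lambda>n. of_bool (b n) * (1/4::real) ^ Suc n)"
  by (rule summable_comparison_test'[where g = "\<lambda>n. (1/4) ^ Suc n" and N = 0])
    (auto simp: summable_geometric)

lemma quarter_powers_sums: "(\<lambda>n. (1/4::real) ^ Suc n) sums (1/3)"
  using sums_mult[OF geometric_sums[of "1/4::real"], of "1/4"] by simp

lemma binary_code_bounds: "0 \<le> binary_code b" "binary_code b \<le> 1/3"
proof -
  show "0 \<le> binary_code b"
    unfolding binary_code_def by (intro suminf_nonneg binary_code_summable) simp
  have "binary_code b \<le> (\<Sum>n. (1/4) ^ Suc n)"
    unfolding binary_code_def using quarter_powers_sums
    by (intro suminf_le binary_code_summable) (auto simp: sums_iff)
  then show "binary_code b \<le> 1/3"
    using quarter_powers_sums by (simp add: sums_iff)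
qed

text \<open>Scaling by \<open>4 ^ Suc n\<close> gives an integer \<open>k\<close>, built from the
  first digits, plus the code of the shifted sequence, which is at most 1/3. Hence \<open>k\<close>
  is the floor, and its parity is its last digit.\<close>

lemma binary_code_digit: "odd \<lfloor>4 ^ Suc n * binary_code b\<rfloor> \<longleftrightarrow> b n"
proof -
  define k :: int where "k = (\<Sum>i<Suc n. of_bool (b i) * 4 ^ (n - i))"
  have "binary_code b = (\<Sum>i. of_bool (b (i + Suc n)) * (1/4) ^ Suc (i + Suc n))
      + (\<Sum>i<Suc n. of_bool (b i) * (1/4) ^ Suc i)"
    unfolding binary_code_def using suminf_split_initial_segment[OF binary_code_summable] .
  moreover have "(\<Sum>i. of_bool (b (i + Suc n)) * (1/4::real) ^ Suc (i + Suc n))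
      = (1/4) ^ Suc n * binary_code (\<lambda>i. b (i + Suc n))"
    unfolding binary_code_def
    by (subst suminf_mult[OF binary_code_summable, symmetric]) (simp add: power_add mult_ac)
  moreover have "4 ^ Suc n * (\<Sum>i<Suc n. of_bool (b i) * (1/4::real) ^ Suc i) = of_int k"
    unfolding k_def of_int_sum sum_distrib_left
  proof (intro sum.cong refl)
    fix i
    assume "i \<in> {..<Suc n}"
    then have "4 ^ Suc n = (4::real) ^ (n - i) * 4 ^ Suc i"
      by (simp flip: power_add)
    then show "4 ^ Suc n * (of_bool (b i) * (1/4::real) ^ Suc i) = of_int (of_bool (b i) * 4 ^ (n - i))"
      by (simp add: power_divide)
  qed
  moreover have "4 ^ Suc n * ((1/4) ^ Suc n * binary_code (\<lambda>i. b (i + Suc n))) = binary_code (\<lambda>i. b (i + Suc n))"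
    by (simp add: power_divide del: power_Suc)
  ultimately have "4 ^ Suc n * binary_code b = of_int k + binary_code (\<lambda>i. b (i + Suc n))"
    by (simp only: distrib_left)
  then have "\<lfloor>4 ^ Suc n * binary_code b\<rfloor> = k"
    using binary_code_bounds[of "\<lambda>i. b (i + Suc n)"] by (simp add: floor_unique)
  moreover have "k = 4 * (\<Sum>i<n. of_bool (b i) * 4 ^ (n - Suc i)) + of_bool (b n)"
    unfolding k_def sum_distrib_left lessThan_Suc
    by (auto intro!: sum.cong simp: mult_ac simp flip: power_Suc)
  ultimately show ?thesis
    by simp
qed

text \<open>This recovers a real from its upper rational cut. The value \<infinity> removes the
  other rationals from the infimum, and extended reals give every such family an infimum, so the
  decoder is defined everywhere.\<close>

lemma real_eq_Inf_rat_above: "ereal x = (INF n. if x < of_rat (from_nat n) then ereal (of_rat (from_nat n)) else \<infinity>)"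
proof (rule antisym)
  show "ereal x \<le> (INF n. if x < of_rat (from_nat n) then ereal (of_rat (from_nat n)) else \<infinity>)"
    by (intro INF_greatest) auto
  show "(INF n. if x < of_rat (from_nat n) then ereal (of_rat (from_nat n)) else \<infinity>) \<le> ereal x"
  proof (rule ereal_le_epsilon2)
    show "\<And>e. 0 < e \<Longrightarrow> (INF n. if x < of_rat (from_nat n) then ereal (of_rat (from_nat n)) else \<infinity>)
        \<le> ereal x + ereal e"
    proof -
      fix e :: real
      assume "e > 0"
      then obtain q where q: "x < of_rat q" "of_rat q < x + e"
        using of_rat_dense[of x "x + e"] by auto
      have "(INF n. if x < of_rat (from_nat n) then ereal (of_rat (from_nat n)) else \<infinity>) \<le> ereal (of_rat q)"
        by (rule INF_lower2[of "to_nat q"]) (use q in auto)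
      then show "(INF n. if x < of_rat (from_nat n) then ereal (of_rat (from_nat n)) else \<infinity>) \<le> ereal x + ereal e"
        using q by (smt (verit) ereal_less_eq(3) order_trans plus_ereal.simps(1))
    qed
  qed
qed

text \<open>The bits are the answers to \<open>x i < q\<close> for all coordinates \<open>i\<close>
  and rationals \<open>q\<close>, with the pairs numbered by \<open>prod_encode\<close>; decoding
  takes the infimum of each cut. A one-sided inverse is all that a retract asks for.\<close>

lemma borel_retract_real:
  obtains f :: "(nat \<Rightarrow> real) \<Rightarrow> real" and g :: "real \<Rightarrow> nat \<Rightarrow> real"
  where "f \<in> borel_measurable borel" "g \<in> borel_measurable borel"
    "\<And>x. g (f x) = x" "range f \<subseteq> {0..1}"
proof
  define b where "b x n \<longleftrightarrow> x (fst (prod_decode n)) < of_rat (from_nat (snd (prod_decode n)))"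
    for x :: "nat \<Rightarrow> real" and n
  \<comment> \<open>For a real that codes no sequence the infimum may be infinite;
    \<open>real_of_ereal\<close> then returns 0.\<close>
  define g where "g t i = real_of_ereal (INF n.
      if odd \<lfloor>4 ^ Suc (prod_encode (i, n)) * t\<rfloor> then ereal (of_rat (from_nat n)) else \<infinity>)"
    for t :: real and i
  note measurable_product_coordinates[measurable]
  show "(\<lambda>x. binary_code (b x)) \<in> borel_measurable borel"
    unfolding binary_code_def b_def of_bool_def by measurable
  show "g \<in> borel_measurable borel"
    unfolding g_def[abs_def] by (rule measurable_coordinatewise_then_product) measurable
  show "g (binary_code (b x)) = x" for x
  proof
    show "g (binary_code (b x)) i = x i" for i
      unfolding g_def binary_code_digit b_def prod_encode_inverse fst_conv snd_conv
      by (subst real_eq_Inf_rat_above[symmetric]) simp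
  qed
  show "range (\<lambda>x. binary_code (b x)) \<subseteq> {0..1}"
    using order_trans[OF binary_code_bounds(2)] binary_code_bounds(1) by (intro image_subsetI) simp
qed

lemma standard_Borel_fun_real: "standard_Borel (borel :: (nat \<Rightarrow> real) measure)"
proof -
  obtain f :: "(nat \<Rightarrow> real) \<Rightarrow> real" and g :: "real \<Rightarrow> nat \<Rightarrow> real"
    where [measurable]: "f \<in> borel_measurable borel" "g \<in> borel_measurable borel"
      and gf: "\<And>x. g (f x) = x"
    using borel_retract_real by metis
  have "{z \<in> space borel. f (g z) = z} \<in> sets borel"
    by measurable
  with standard_Borel_real have "standard_Borel (restrict_space borel {z \<in> space borel. f (g z) = z})"
    by (rule standard_Borel_restrict_space)
  moreover have "Borel_isomorphic (borel :: (nat \<Rightarrow> real) measure) (restrict_space borel {z \<in> space borel. f (g z) = z})"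
    by (intro Borel_isomorphic_retract) (simp_all add: gf)
  ultimately show ?thesis
    by (rule standard_Borel_isomorphic[rotated])
qed

section \<open>Polish spaces in the sequence space, standard Borel spaces in the unit
  interval\<close>

lemma homeomorphic_map_imp_Borel_isomorphic:
  assumes "homeomorphic_map X (top_of_set C) F"
  shows "Borel_isomorphic (borel_of_topology X) (restrict_space borel C)"
proof -
  obtain G where hom: "homeomorphic_maps X (top_of_set C) F G"
    using assms homeomorphic_map_maps by blast
  then have cont: "continuous_map X (top_of_set C) F" "continuous_map (top_of_set C) X G"
    and inv: "\<And>x. x \<in> topspace X \<Longrightarrow> G (F x) = x" "\<And>y. y \<in> C \<Longrightarrow> F (G y) = y"
    by (auto simp: homeomorphic_maps_def)
  have sub: "{U. openin X U} \<subseteq> Pow (topspace X)"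
    by (auto dest: openin_subset)
  then have sp: "space (borel_of_topology X) = topspace X"
    by (simp add: borel_of_topology_def space_measure_of_conv)
  show ?thesis
  proof (rule Borel_isomorphicI)
    have FC: "F x \<in> C" if "x \<in> topspace X" for x
      using cont(1) that by (auto simp: continuous_map_def)
    have "F \<in> measurable (borel_of_topology X) borel"
    proof (rule borel_measurableI)
      fix S :: "'b set"
      assume "open S"
      then have "openin X {x \<in> topspace X. F x \<in> S}"
        using cont(1) \<open>open S\<close> openin_continuous_map_preimage[of X euclidean F S]
        by (simp add: continuous_map_in_subtopology)
      moreover have "F -` S \<inter> space (borel_of_topology X) = {x \<in> topspace X. F x \<in> S}"
        by (auto simp: sp)
      ultimately show "F -` S \<inter> space (borel_of_topology X) \<in> sets (borel_of_topology X)"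
        using sub by (simp add: borel_of_topology_def)
    qed
    then show "F \<in> measurable (borel_of_topology X) (restrict_space borel C)"
      using FC by (intro measurable_restrict_space2) (auto simp: sp)
    show "G \<in> measurable (restrict_space borel C) (borel_of_topology X)"
      unfolding borel_of_topology_def
    proof (rule measurable_measure_of[OF sub])
      show "G \<in> space (restrict_space borel C) \<rightarrow> topspace X"
        using cont(2) by (auto simp: space_restrict_space continuous_map_def)
      fix U assume "U \<in> {U. openin X U}"
      then have "openin (top_of_set C) {y \<in> C. G y \<in> U}"
        using cont(2) by (auto simp: continuous_map_def)
      then obtain T where T: "open T" "{y \<in> C. G y \<in> U} = C \<inter> T"
        by (auto simp: openin_open)
      have "G -` U \<inter> space (restrict_space borel C) = C \<inter> T"
        using T(2) by (auto simp: space_restrict_space)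
      then show "G -` U \<inter> space (restrict_space borel C) \<in> sets (restrict_space borel C)"
        using T(1) by (auto simp: sets_restrict_space)
    qed
  qed (use inv in \<open>auto simp: sp space_restrict_space\<close>)
qed

text \<open>An enumerated countable dense subset takes the place of the dense sections.\<close>

lemma Polish_space_closed_embedding:
  assumes "Polish_space P"
  obtains C :: "(nat \<Rightarrow> real) set" and F where "closed C" "homeomorphic_map P (top_of_set C) F"
proof (cases "topspace P = {}")
  \<comment> \<open>\<open>from_nat_into\<close> enumerates only nonempty sets, so the empty space
    is separate.\<close>
  case True
  then have "homeomorphic_map P (top_of_set ({} :: (nat \<Rightarrow> real) set)) undefined"
    by (simp add: homeomorphic_map_def quotient_map_def flip: null_topspace_iff_trivial)
  then show ?thesis
    by (intro that[of "{}"]) auto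
next
  case False
  obtain M d where "Metric_space M d" "Metric_space.mcomplete M d"
    and P: "P = Metric_space.mtopology M d"
    using assms by (auto simp: Polish_space_def completely_metrizable_space_def)
  interpret Metric_space M d by fact
  obtain D where D: "countable D" "D \<subseteq> M" "mtopology closure_of D = M"
    using assms by (auto simp: Polish_space_def separable_space_def P)
  moreover have "D \<noteq> {}"
    using D False by (auto simp: P)
  ultimately have "range (from_nat_into D) = D"
    by simp
  then show ?thesis
    using that[of "(\<lambda>v. closed_code (\<lambda>n. d v (from_nat_into D n))) ` M"]
      closed_image_closed_code[of "from_nat_into D" M] homeomorphic_map_closed_code[of "from_nat_into D"]
      \<open>mcomplete\<close> D P by simp
qed

text \<open>A Borel subset of a Polish space is carried to one of a closed subset of the sequence
  space, and then into the interval by the pair \<open>f\<close>, \<open>g\<close>. This is why a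
  single factor \<open>{0..1}\<close> can accommodate every base space.\<close>

lemma standard_Borel_imp_unit_interval:
  assumes "standard_Borel M"
  obtains B :: "real set" where "B \<in> sets borel" "B \<subseteq> {0..1}" "Borel_isomorphic M (restrict_space borel B)"
proof -
  obtain P :: "real topology" and A where PA: "Polish_space P" "A \<in> sets (borel_of_topology P)"
    "Borel_isomorphic M (restrict_space (borel_of_topology P) A)"
    using assms unfolding standard_Borel_def by blast
  obtain C :: "(nat \<Rightarrow> real) set" and F where C: "closed C" "homeomorphic_map P (top_of_set C) F"
    using Polish_space_closed_embedding[OF PA(1)] .
  obtain f :: "(nat \<Rightarrow> real) \<Rightarrow> real" and g :: "real \<Rightarrow> nat \<Rightarrow> real"
    where fg [measurable]: "f \<in> borel_measurable borel" "g \<in> borel_measurable borel"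
      and gf: "\<And>x. g (f x) = x" and f01: "range f \<subseteq> {0..1}"
    using borel_retract_real by metis
  obtain A' where A': "A' \<in> sets (restrict_space borel C)"
    "Borel_isomorphic (restrict_space (borel_of_topology P) A) (restrict_space (restrict_space borel C) A')"
    using Borel_isomorphic_restrict_space[OF homeomorphic_map_imp_Borel_isomorphic[OF C(2)] PA(2)] .
  have A'_borel [measurable]: "A' \<in> sets borel" and "A' \<subseteq> C"
    using A'(1) C(1) by (auto simp: sets_restrict_space_iff)
  have sets: "sets (restrict_space (restrict_space borel C) A') = sets (restrict_space borel A')"
    using \<open>A' \<subseteq> C\<close> by (simp add: sets_restrict_restrict_space Int_absorb1)
  \<comment> \<open>\<open>B\<close> is the image of \<open>A'\<close> under \<open>f\<close>,
    written so that its measurability is evident.\<close>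
  define B where "B = {z. f (g z) = z \<and> g z \<in> A'}"
  have "B \<in> sets borel"
  proof -
    have "{z \<in> space borel. f (g z) = z \<and> g z \<in> A'} \<in> sets borel"
      by measurable
    then show ?thesis
      by (simp add: B_def)
  qed
  moreover have "B \<subseteq> {0..1}"
  proof
    fix z assume "z \<in> B"
    then have "z = f (g z)"
      by (simp add: B_def)
    then show "z \<in> {0..1}"
      using f01 by blast
  qed
  moreover have "Borel_isomorphic (restrict_space borel A') (restrict_space borel B)"
  proof (rule Borel_isomorphicI[of f _ _ g])
    show "f \<in> measurable (restrict_space borel A') (restrict_space borel B)"
      by (intro measurable_restrict_space2 measurable_restrict_space1)
        (auto simp: B_def gf space_restrict_space)
    show "g \<in> measurable (restrict_space borel B) (restrict_space borel A')"
      by (intro measurable_restrict_space2 measurable_restrict_space1)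
        (auto simp: B_def gf space_restrict_space)
  qed (auto simp: gf B_def space_restrict_space)
  moreover have "Borel_isomorphic M (restrict_space borel A')"
    using Borel_isomorphic_trans[OF PA(3) Borel_isomorphic_trans[OF A'(2) Borel_isomorphic_sets_eq[OF sets]]] .
  ultimately show ?thesis
    using that[of B] Borel_isomorphic_trans[of M "restrict_space borel A'" "restrict_space borel B"] by simp
qed

text \<open>Through such a \<open>j\<close>, equality of two Borel maps into \<open>M\<close>
  becomes an equation between real functions, so coincidence sets are measurable.\<close>

lemma standard_Borel_separated:
  assumes "standard_Borel M"
  obtains j :: "_ \<Rightarrow> real" where "j \<in> borel_measurable M" "inj_on j (space M)"
proof -
  obtain B :: "real set" where "Borel_isomorphic M (restrict_space borel B)"
    using standard_Borel_imp_unit_interval[OF assms] .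
  then obtain f g where f: "f \<in> measurable M (restrict_space borel B)"
    and gf: "\<forall>x\<in>space M. g (f x) = x"
    unfolding Borel_isomorphic_def by blast
  show ?thesis
  proof (rule that)
    show "f \<in> borel_measurable M"
      using f by (simp add: measurable_restrict_space2_iff)
    show "inj_on f (space M)"
      using gf by (intro inj_on_inverseI[where g = g]) simp
  qed
qed

lemma standard_Borel_retract:
  assumes f: "f \<in> measurable M N" and g: "g \<in> measurable N M"
    and gf: "\<And>x. x \<in> space M \<Longrightarrow> g (f x) = x" and N: "standard_Borel N"
  shows "standard_Borel M"
proof -
  obtain j :: "_ \<Rightarrow> real" where j: "j \<in> borel_measurable N" "inj_on j (space N)"
    using standard_Borel_separated[OF N] .
  note [measurable] = f g j(1)
  have "{z \<in> space N. j (f (g z)) = j z} \<in> sets N"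
    by measurable
  also have "{z \<in> space N. j (f (g z)) = j z} = {z \<in> space N. f (g z) = z}"
    using inj_on_eq_iff[OF j(2)] measurable_space[OF f] measurable_space[OF g] by auto
  finally have "standard_Borel (restrict_space N {z \<in> space N. f (g z) = z})"
    by (rule standard_Borel_restrict_space[OF N])
  with Borel_isomorphic_retract[OF f g gf] show ?thesis
    by (rule standard_Borel_isomorphic)
qed

text \<open>Both factors are Borel subsets of the line, and coordinates 0 and 1 of a real sequence
  hold a pair. The remaining coordinates repeat the second entry, so the embedding is in general not
  onto \<open>S\<close>; a retract is enough.\<close>

lemma standard_Borel_pair:
  assumes "standard_Borel M" "standard_Borel N"
  shows "standard_Borel (M \<Otimes>\<^sub>M N)"
proof -
  obtain B :: "real set" where B: "B \<in> sets borel" "Borel_isomorphic M (restrict_space borel B)"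
    using standard_Borel_imp_unit_interval[OF assms(1)] by metis
  obtain C :: "real set" where C: "C \<in> sets borel" "Borel_isomorphic N (restrict_space borel C)"
    using standard_Borel_imp_unit_interval[OF assms(2)] by metis
  obtain f g where f: "f \<in> measurable M (restrict_space borel B)" and g: "g \<in> measurable (restrict_space borel B) M"
    and gf: "\<And>x. x \<in> space M \<Longrightarrow> g (f x) = x"
    using B(2) unfolding Borel_isomorphic_def by blast
  obtain h k where h: "h \<in> measurable N (restrict_space borel C)" and k: "k \<in> measurable (restrict_space borel C) N"
    and kh: "\<And>x. x \<in> space N \<Longrightarrow> k (h x) = x"
    using C(2) unfolding Borel_isomorphic_def by blast
  have coord: "(\<lambda>z :: nat \<Rightarrow> real. z i) \<in> borel_measurable borel" for i
    by (rule measurable_product_coordinates)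
  define S where "S = {z :: nat \<Rightarrow> real. z 0 \<in> B \<and> z 1 \<in> C}"
  have S: "S \<in> sets borel"
    using sets.Int[OF measurable_sets[OF coord[of 0] B(1)] measurable_sets[OF coord[of 1] C(1)]]
    by (simp add: S_def vimage_def Collect_conj_eq)
  have "f \<in> borel_measurable M" "h \<in> borel_measurable N"
    using f h by (blast dest: measurable_restrict_space2_iff[THEN iffD1])+
  note [measurable] = this
  have "(\<lambda>p i. if i = 0 then f (fst p) else h (snd p)) \<in> measurable (M \<Otimes>\<^sub>M N) (borel :: (nat \<Rightarrow> real) measure)"
  proof (rule measurable_coordinatewise_then_product)
    show "(\<lambda>p. if i = 0 then f (fst p) else h (snd p)) \<in> borel_measurable (M \<Otimes>\<^sub>M N)" for i :: nat
      by (cases "i = 0") simp_all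
  qed
  then have into: "(\<lambda>p i. if i = 0 then f (fst p) else h (snd p)) \<in> measurable (M \<Otimes>\<^sub>M N) (restrict_space borel S)"
    using measurable_space[OF f] measurable_space[OF h]
    by (intro measurable_restrict_space2) (auto simp: S_def space_pair_measure space_restrict_space)
  have "(\<lambda>z. z 0) \<in> measurable (restrict_space borel S) (restrict_space borel B)"
    by (intro measurable_restrict_space2 measurable_restrict_space1 coord) (auto simp: S_def space_restrict_space)
  moreover have "(\<lambda>z. z 1) \<in> measurable (restrict_space borel S) (restrict_space borel C)"
    by (intro measurable_restrict_space2 measurable_restrict_space1 coord) (auto simp: S_def space_restrict_space)
  ultimately have onto: "(\<lambda>z. (g (z 0), k (z 1))) \<in> measurable (restrict_space borel S) (M \<Otimes>\<^sub>M N)"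
    using g k by (intro measurable_Pair measurable_compose[where f = "\<lambda>z. z 0" and g = g]
      measurable_compose[where f = "\<lambda>z. z 1" and g = k])
  show ?thesis
    using into onto by (rule standard_Borel_retract)
      (auto simp: gf kh space_pair_measure standard_Borel_restrict_space[OF standard_Borel_fun_real S])
qed

subsection \<open>The Effros Borel space\<close>

lemma Polish_space_closed_subset:
  fixes K :: "'u::polish_space set"
  assumes "closed K"
  shows "Polish_space (top_of_set K)"
  unfolding Polish_space_def
  using assms
  by (auto intro!: completely_metrizable_space_closedin completely_metrizable_space_euclidean
      second_countable_imp_separable_space second_countable_subtopology second_countable_euclidean)

lemma standard_Borel_borel: "standard_Borel (borel :: 'u::polish_space measure)"
proof -
  have "Polish_space (euclidean :: 'u topology)"
    using Polish_space_closed_subset[of UNIV] by simp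
  then obtain C :: "(nat \<Rightarrow> real) set" and F
    where "closed C" "homeomorphic_map (euclidean :: 'u topology) (top_of_set C) F"
    by (rule Polish_space_closed_embedding)
  then show ?thesis
    using standard_Borel_isomorphic standard_Borel_restrict_space[OF standard_Borel_fun_real]
      homeomorphic_map_imp_Borel_isomorphic borel_of_topology_euclidean
    by (metis borel_closed)
qed

lemma space_Effros: "space Effros = {K. closed K \<and> K \<noteq> {}}"
  unfolding Effros_def by (rule space_measure_of) blast

lemma sets_Effros_hit: "open G \<Longrightarrow> {K \<in> space Effros. K \<inter> G \<noteq> {}} \<in> sets Effros"
  unfolding space_Effros by (auto simp: Effros_def intro!: sigma_sets.Basic exI[of _ G])

lemma measurable_EffrosI:
  assumes "\<And>x. x \<in> space M \<Longrightarrow> closed (f x) \<and> f x \<noteq> {}"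
    and "\<And>G. open G \<Longrightarrow> {x \<in> space M. f x \<inter> G \<noteq> {}} \<in> sets M"
  shows "f \<in> measurable M Effros"
  unfolding Effros_def
proof (rule measurable_measure_of)
  fix S
  assume "S \<in> {{K :: 'b set. closed K \<and> K \<noteq> {} \<and> K \<inter> G \<noteq> {}} |G. open G}"
  then obtain G where G: "open G" "S = {K. closed K \<and> K \<noteq> {} \<and> K \<inter> G \<noteq> {}}"
    by blast
  then have "f -` S \<inter> space M = {x \<in> space M. f x \<inter> G \<noteq> {}}"
    using assms(1) by auto
  then show "f -` S \<inter> space M \<in> sets M"
    using assms(2)[OF G(1)] by simp
qed (use assms(1) in auto)

text \<open>The last property drives nested choices: the closure keeps a limit inside the earlier
  open set, and centring the ball at \<open>c m\<close> makes smallness a condition on the index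
  \<open>m\<close> alone.\<close>

lemma countable_basis_refinement:
  obtains B :: "nat \<Rightarrow> 'u::{metric_space, second_countable_topology} set" and c :: "nat \<Rightarrow> 'u"
  where "\<forall>n. open (B n)"
    and "\<forall>x S. open S \<and> x \<in> S \<longrightarrow> (\<exists>n. x \<in> B n \<and> B n \<subseteq> S)"
    and "\<forall>n. B n \<noteq> {} \<longrightarrow> c n \<in> B n"
    and "\<forall>n. \<forall>x\<in>B n. \<forall>e>0. \<exists>m. x \<in> B m \<and> closure (B m) \<subseteq> B n \<and> B m \<subseteq> ball (c m) e"
proof -
  obtain \<B> :: "'u set set" where \<B>: "countable \<B>" "topological_basis \<B>"
    using ex_countable_basis by blast
  have "\<B> \<noteq> {}"
    using topological_basisE[OF \<B>(2) open_UNIV UNIV_I] by blast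
  define B where "B = from_nat_into \<B>"
  have range: "range B = \<B>"
    unfolding B_def using \<B>(1) \<open>\<B> \<noteq> {}\<close> by simp
  define c where "c n = (SOME x. x \<in> B n)" for n
  have "open (B n)" for n
    using topological_basis_open[OF \<B>(2)] range by blast
  moreover have basis: "\<exists>n. x \<in> B n \<and> B n \<subseteq> S" if "open S" "x \<in> S" for x S
    using topological_basisE[OF \<B>(2) that] range by (metis imageE)
  moreover have c: "c n \<in> B n" if "B n \<noteq> {}" for n
    using that unfolding c_def by (simp add: some_in_eq)
  moreover have "\<exists>m. x \<in> B m \<and> closure (B m) \<subseteq> B n \<and> B m \<subseteq> ball (c m) e"
    if "x \<in> B n" "e > 0" for n x e
  proof -
    obtain r where r: "r > 0" "cball x r \<subseteq> B n"
      using \<open>open (B n)\<close> \<open>x \<in> B n\<close> open_contains_cball by blast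
    \<comment> \<open>Radius \<open>r\<close> keeps the closure inside \<open>B n\<close>;
      \<open>e / 2\<close> brings \<open>c m\<close> and any other point of \<open>B m\<close>
      within \<open>e\<close> of each other.\<close>
    define \<delta> where "\<delta> = min r (e / 2)"
    have "\<delta> > 0"
      using r \<open>e > 0\<close> by (simp add: \<delta>_def)
    then obtain m where m: "x \<in> B m" "B m \<subseteq> ball x \<delta>"
      using basis[of "ball x \<delta>" x] by auto
    have "closure (B m) \<subseteq> cball x \<delta>"
      using m(2) by (meson ball_subset_cball closed_cball closure_minimal order_trans)
    also have "\<dots> \<subseteq> B n"
      using r(2) by (auto simp: \<delta>_def)
    finally have "closure (B m) \<subseteq> B n" .
    moreover have "dist (c m) y < e" if "y \<in> B m" for y
    proof -
      have "dist x (c m) < \<delta>" "dist x y < \<delta>"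
        using c[of m] that m by (auto simp: subset_iff)
      then show ?thesis
        using dist_triangle2[of "c m" y x] by (simp add: \<delta>_def dist_commute)
    qed
    ultimately show ?thesis
      using m(1) by auto
  qed
  ultimately show ?thesis
    by (intro that[of B c]) auto
qed

text \<open>
  The selectors follow a shrinking chain of basic open sets that meet the given closed set, always
  taking the least admissible index so that every choice is measurable.
\<close>

theorem Effros_dense_selectors:
  obtains \<sigma> :: "nat \<Rightarrow> 'u::polish_space set \<Rightarrow> 'u"
  where "\<forall>n. \<sigma> n \<in> borel_measurable Effros"
    and "\<forall>K\<in>space Effros. closure (range (\<lambda>n. \<sigma> n K)) = K"
proof -
  obtain B :: "nat \<Rightarrow> 'u set" and c where "\<forall>n. open (B n)"
    and "\<forall>x S. open S \<and> x \<in> S \<longrightarrow> (\<exists>n. x \<in> B n \<and> B n \<subseteq> S)"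
    and "\<forall>n. B n \<noteq> {} \<longrightarrow> c n \<in> B n"
    and "\<forall>n. \<forall>x\<in>B n. \<forall>e>0. \<exists>m. x \<in> B m \<and> closure (B m) \<subseteq> B n \<and> B m \<subseteq> ball (c m) e"
    using countable_basis_refinement .
  then have open_B: "open (B n)"
    and basis: "open S \<Longrightarrow> x \<in> S \<Longrightarrow> \<exists>n. x \<in> B n \<and> B n \<subseteq> S"
    and c: "B n \<noteq> {} \<Longrightarrow> c n \<in> B n"
    and refine: "x \<in> B n \<Longrightarrow> e > 0 \<Longrightarrow>
           \<exists>m. x \<in> B m \<and> closure (B m) \<subseteq> B n \<and> B m \<subseteq> ball (c m) e" for n x S e
    by blast+
  have hit [measurable]: "Measurable.pred Effros (\<lambda>K. K \<inter> B n \<noteq> {})" for n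
    unfolding pred_def using open_B by (rule sets_Effros_hit)
  \<comment> \<open>Starting at \<open>n\<close> whenever \<open>K\<close> meets \<open>B n\<close>
    forces the selected point into \<open>B n\<close>, which is the source of density. Otherwise the
    least index is a fallback that still meets \<open>K\<close>.\<close>
  define start where "start n K = (if K \<inter> B n \<noteq> {} then n else LEAST m. K \<inter> B m \<noteq> {})" for n K
  define ok where "ok j n m \<longleftrightarrow> closure (B m) \<subseteq> B n \<and> B m \<subseteq> ball (c m) ((1/2) ^ j)" for j n m
  define chain where "chain n K = rec_nat (start n K) (\<lambda>j i. LEAST m. K \<inter> B m \<noteq> {} \<and> ok j i m)"
    for n K
  have chain_0: "chain n K 0 = start n K"
    and chain_Suc: "chain n K (Suc j) = (LEAST m. K \<inter> B m \<noteq> {} \<and> ok j (chain n K j) m)" for n K j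
    by (simp_all add: chain_def)
  have start_meas: "start n \<in> measurable Effros (count_space UNIV)" for n
    unfolding start_def[abs_def] by measurable
  have chain_meas: "(\<lambda>K. chain n K j) \<in> measurable Effros (count_space UNIV)" for n j
  proof (induction j)
    case 0
    then show ?case
      using start_meas by (simp add: chain_0)
  next
    case (Suc j)
    note [measurable] = Suc
    \<comment> \<open>The condition depends on \<open>K\<close> only through the natural number
      \<open>chain n K j\<close>, and every predicate on a discrete countable space is
      measurable.\<close>
    have "Measurable.pred Effros (\<lambda>K. ok j (chain n K j) m)" for m
      by (rule measurable_compose[OF Suc]) simp
    note [measurable] = this
    show ?case
      unfolding chain_Suc by measurable
  qed
  have start: "K \<inter> B (start n K) \<noteq> {}" if "K \<in> space Effros" for n K
  proof -
    obtain x where "x \<in> K"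
      using \<open>K \<in> space Effros\<close> by (auto simp: space_Effros)
    then have "\<exists>m. K \<inter> B m \<noteq> {}"
      using basis[of UNIV x] by auto
    then show ?thesis
      using LeastI_ex[of "\<lambda>m. K \<inter> B m \<noteq> {}"] by (simp add: start_def)
  qed
  have chain_step: "K \<inter> B (chain n K (Suc j)) \<noteq> {} \<and> ok j (chain n K j) (chain n K (Suc j))"
    if "K \<inter> B (chain n K j) \<noteq> {}" for n K j
  proof -
    have "\<exists>m. K \<inter> B m \<noteq> {} \<and> ok j (chain n K j) m"
      using that refine[of _ "chain n K j" "(1/2) ^ j"] unfolding ok_def by fastforce
    then show ?thesis
      unfolding chain_Suc by (rule LeastI_ex)
  qed
  \<comment> \<open>\<open>Suc j\<close>, because \<open>ok j\<close> bounds the size of the set at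
    stage \<open>Suc j\<close>; the starting set has no bound.\<close>
  define a where "a n K j = c (chain n K (Suc j))" for n K j
  have limit: "\<exists>l \<in> K \<inter> B (start n K). a n K \<longlonglongrightarrow> l" if K: "K \<in> space Effros" for n K
  proof -
    have hits: "K \<inter> B (chain n K j) \<noteq> {}" for j
      using start[OF K] chain_step by (induction j) (auto simp: chain_0)
    have ok: "ok j (chain n K j) (chain n K (Suc j))" for j
      using chain_step[OF hits] by blast
    then have "B (chain n K (Suc j)) \<subseteq> B (chain n K j)" for j
      using closure_subset unfolding ok_def by blast
    then have anti: "B (chain n K j) \<subseteq> B (chain n K i)" if "i \<le> j" for i j
      using lift_Suc_antimono_le[of "\<lambda>j. B (chain n K j)", OF _ that] by blast
    have a_in: "a n K j \<in> B (chain n K (Suc j))" for j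
      unfolding a_def using hits[of "Suc j"] by (intro c) auto
    have near: "dist (a n K j) x < (1/2) ^ j" if "x \<in> B (chain n K (Suc j))" for j x
      using ok[of j] that unfolding ok_def a_def by auto
    have small: "\<exists>j. (1/2) ^ j < e" if "e > 0" for e :: real
      using that by (intro real_arch_pow_inv) auto
    have "Cauchy (a n K)"
      unfolding Cauchy_altdef
    proof (intro allI impI)
      fix e :: real
      assume "e > 0"
      then obtain j where j: "(1/2) ^ j < e / 2"
        using small[of "e / 2"] by auto
      have "dist (a n K i) (a n K k) < e" if "j \<le> i" "i < k" for i k
      proof -
        have "dist (a n K i) (a n K k) < (1/2) ^ i"
          using a_in[of k] anti[of "Suc i" "Suc k"] that by (intro near) auto
        also have "\<dots> \<le> (1/2) ^ j"
          using that by (intro power_decreasing) auto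
        finally show ?thesis
          using j \<open>e > 0\<close> by linarith
      qed
      then show "\<exists>M. \<forall>m\<ge>M. \<forall>k>m. dist (a n K m) (a n K k) < e"
        by blast
    qed
    then obtain l where l: "a n K \<longlonglongrightarrow> l"
      using Cauchy_convergent convergent_def by blast
    \<comment> \<open>The closure of the first refined set lies in \<open>B (start n K)\<close>, so
      the limit does not escape that open set.\<close>
    have "l \<in> closure (B (chain n K (Suc 0)))"
    proof (rule closed_sequentially[OF closed_closure _ l])
      show "a n K j \<in> closure (B (chain n K (Suc 0)))" for j
        using a_in[of j] anti[of "Suc 0" "Suc j"] closure_subset by blast
    qed
    then have "l \<in> B (start n K)"
      using ok[of 0] unfolding ok_def chain_0 by blast
    moreover have "l \<in> K"
    proof -
      \<comment> \<open>The centres \<open>a n K j\<close> may lie outside \<open>K\<close>; points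
        \<open>k j\<close> of \<open>K\<close> in the same shrinking sets have the same
        limit.\<close>
      have "\<forall>j. \<exists>x. x \<in> K \<inter> B (chain n K (Suc j))"
        using hits by blast
      then obtain k where k: "\<And>j. k j \<in> K \<inter> B (chain n K (Suc j))"
        by metis
      have "(\<lambda>j. dist (a n K j) (k j)) \<longlonglongrightarrow> 0"
      proof (rule tendsto_sandwich)
        show "\<forall>\<^sub>F j in sequentially. dist (a n K j) (k j) \<le> (1/2) ^ j"
          using near k by (auto intro!: always_eventually less_imp_le)
      qed (auto intro: LIMSEQ_power_zero)
      then have "(\<lambda>j. dist (a n K j) (k j) + dist (a n K j) l) \<longlonglongrightarrow> 0"
        using l tendsto_add_zero unfolding tendsto_dist_iff[of "a n K"] by blast
      then have "(\<lambda>j. dist (k j) l) \<longlonglongrightarrow> 0"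
        by (rule Lim_null_comparison[rotated])
          (auto intro!: always_eventually simp: dist_triangle3)
      then have "k \<longlonglongrightarrow> l"
        by (rule tendsto_dist_iff[THEN iffD2])
      then show ?thesis
        using K k closed_sequentially[of K k l] by (auto simp: space_Effros)
    qed
    ultimately show ?thesis
      using l by blast
  qed
  define \<sigma> where "\<sigma> n K = lim (a n K)" for n K
  have \<sigma>: "a n K \<longlonglongrightarrow> \<sigma> n K" "\<sigma> n K \<in> K" "\<sigma> n K \<in> B (start n K)" if K: "K \<in> space Effros" for n K
  proof -
    obtain l where "l \<in> K \<inter> B (start n K)" "a n K \<longlonglongrightarrow> l"
      using limit[OF K] by blast
    then show "a n K \<longlonglongrightarrow> \<sigma> n K" "\<sigma> n K \<in> K" "\<sigma> n K \<in> B (start n K)"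
      by (simp_all add: \<sigma>_def limI)
  qed
  have "\<sigma> n \<in> borel_measurable Effros" for n
  proof (rule borel_measurable_LIMSEQ_metric)
    show "(\<lambda>K. a n K j) \<in> borel_measurable Effros" for j
      unfolding a_def by (rule measurable_compose[OF chain_meas]) simp
  qed (rule \<sigma>(1))
  moreover have "closure (range (\<lambda>n. \<sigma> n K)) = K" if K: "K \<in> space Effros" for K
  proof
    show "closure (range (\<lambda>n. \<sigma> n K)) \<subseteq> K"
      using K \<sigma>(2) by (intro closure_minimal) (auto simp: space_Effros)
    show "K \<subseteq> closure (range (\<lambda>n. \<sigma> n K))"
    proof
      fix x assume "x \<in> K"
      show "x \<in> closure (range (\<lambda>n. \<sigma> n K))"
        unfolding closure_iff_nhds_not_empty
      proof (intro allI impI)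
        fix A S
        assume "S \<subseteq> A" "open S" "x \<in> S"
        then obtain n where "x \<in> B n" "B n \<subseteq> S"
          using basis by blast
        moreover have "start n K = n"
          using \<open>x \<in> K\<close> \<open>x \<in> B n\<close> by (auto simp: start_def)
        ultimately have "\<sigma> n K \<in> A"
          using \<sigma>(3)[OF K, of n] \<open>S \<subseteq> A\<close> by auto
        then show "range (\<lambda>n. \<sigma> n K) \<inter> A \<noteq> {}"
          by blast
      qed
    qed
  qed
  ultimately show ?thesis
    by (intro that[of \<sigma>]) auto
qed

lemma standard_Borel_Effros: "standard_Borel (Effros :: 'u::polish_space set measure)"
proof -
  obtain \<sigma> :: "nat \<Rightarrow> 'u set \<Rightarrow> 'u" where \<sigma>: "\<forall>n. \<sigma> n \<in> borel_measurable Effros"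
    "\<forall>K\<in>space Effros. closure (range (\<lambda>n. \<sigma> n K)) = K"
    using Effros_dense_selectors .
  have "(\<lambda>K n. \<sigma> n K) \<in> borel_measurable Effros"
    using \<sigma>(1) by (intro measurable_coordinatewise_then_product) blast
  moreover have "(\<lambda>z. closure (range z)) \<in> measurable (borel :: (nat \<Rightarrow> 'u) measure) Effros"
  proof (rule measurable_EffrosI)
    fix G :: "'u set"
    assume "open G"
    then have "{z :: nat \<Rightarrow> 'u. z n \<in> G} \<in> sets borel" for n
      using measurable_sets[OF measurable_product_coordinates[of n] borel_open[of G]]
      by (simp add: vimage_def)
    then have "(\<Union>n. {z :: nat \<Rightarrow> 'u. z n \<in> G}) \<in> sets borel"
      by blast
    \<comment> \<open>An open set meets the closure of the range exactly when it contains some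
      \<open>z n\<close>.\<close>
    also have "(\<Union>n. {z :: nat \<Rightarrow> 'u. z n \<in> G}) = {z \<in> space borel. closure (range z) \<inter> G \<noteq> {}}"
      using open_Int_closure_eq_empty[OF \<open>open G\<close>] by (auto simp: Int_commute)
    finally show "{z :: nat \<Rightarrow> 'u \<in> space borel. closure (range z) \<inter> G \<noteq> {}} \<in> sets borel" .
  qed simp
  ultimately show ?thesis
    by (rule standard_Borel_retract) (use \<sigma>(2) standard_Borel_borel in auto)
qed

subsection \<open>Borel fields\<close>

lemma standard_Borel_restrict_space_Int:
  assumes "standard_Borel M" "A \<inter> space M \<in> sets M"
  shows "standard_Borel (restrict_space M A)"
proof -
  have "sets (restrict_space M A) = sets (restrict_space M (A \<inter> space M))"
    unfolding sets_restrict_space by (intro image_cong refl) (auto dest: sets.sets_into_space)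
  then show ?thesis
    using standard_Borel_restrict_space[OF assms] standard_Borel_sets_cong by blast
qed

text \<open>Density of the selectors turns membership in the closed set \<open>\<gamma> y\<close>
  into distance zero from them, a condition with countable quantifiers.\<close>

lemma Effros_graph_measurable:
  fixes \<gamma> :: "'y \<Rightarrow> 'u::polish_space set"
  assumes \<gamma> [measurable]: "\<gamma> \<in> measurable Y Effros"
  shows "{(y, u). u \<in> \<gamma> y} \<inter> space (Y \<Otimes>\<^sub>M borel) \<in> sets (Y \<Otimes>\<^sub>M borel)"
proof -
  obtain \<sigma> :: "nat \<Rightarrow> 'u set \<Rightarrow> 'u" where meas: "\<forall>n. \<sigma> n \<in> borel_measurable Effros"
    and dense: "\<forall>K\<in>space Effros. closure (range (\<lambda>n. \<sigma> n K)) = K"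
    using Effros_dense_selectors .
  have [measurable]: "\<sigma> n \<in> borel_measurable Effros" for n
    using meas by blast
  have "u \<in> \<gamma> y \<longleftrightarrow> (\<forall>k. \<exists>n. dist (\<sigma> n (\<gamma> y)) u < inverse (real (Suc k)))" if "y \<in> space Y" for y u
  proof -
    have "u \<in> \<gamma> y \<longleftrightarrow> u \<in> closure (range (\<lambda>n. \<sigma> n (\<gamma> y)))"
      using dense measurable_space[OF \<gamma> that] by simp
    also have "\<dots> \<longleftrightarrow> (\<forall>e>0. \<exists>n. dist (\<sigma> n (\<gamma> y)) u < e)"
      by (simp add: closure_approachable)
    also have "\<dots> \<longleftrightarrow> (\<forall>k. \<exists>n. dist (\<sigma> n (\<gamma> y)) u < inverse (real (Suc k)))"
      by (metis inverse_positive_iff_positive less_trans of_nat_0_less_iff reals_Archimedean zero_less_Suc)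
    finally show ?thesis .
  qed
  then have "{(y, u). u \<in> \<gamma> y} \<inter> space (Y \<Otimes>\<^sub>M borel) =
      {p \<in> space (Y \<Otimes>\<^sub>M borel). \<forall>k. \<exists>n. dist (\<sigma> n (\<gamma> (fst p))) (snd p) < inverse (real (Suc k))}"
    by (auto simp: space_pair_measure)
  also have "\<dots> \<in> sets (Y \<Otimes>\<^sub>M borel)"
    by measurable
  finally show ?thesis .
qed

text \<open>The ambient complete metric stays complete on closed sets, and the selectors composed
  with \<open>\<gamma>\<close> are the dense sections.\<close>

lemma Borel_field_closed_sets_field:
  fixes \<gamma> :: "'y \<Rightarrow> 'u::polish_space set"
  assumes Y: "standard_Borel Y" and \<gamma>: "\<gamma> \<in> measurable Y Effros"
  shows "Borel_field (closed_sets_field Y \<gamma>)"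
proof -
  define T where "T = restrict_space (Y \<Otimes>\<^sub>M (borel :: 'u measure)) {(y, u). u \<in> \<gamma> y}"
  have V: "base (closed_sets_field Y \<gamma>) = Y" "fibre (closed_sets_field Y \<gamma>) = (\<lambda>y. top_of_set (\<gamma> y))"
    "total (closed_sets_field Y \<gamma>) = T"
    by (simp_all add: closed_sets_field_def T_def)
  have closed: "closed (\<gamma> y)" if "y \<in> space Y" for y
    using measurable_space[OF \<gamma> that] by (simp add: space_Effros)
  have fst_T: "fst \<in> measurable T Y" and snd_T: "snd \<in> borel_measurable T"
    unfolding T_def by (auto intro: measurable_restrict_space1)
  have "standard_Borel T"
    unfolding T_def using Effros_graph_measurable[OF \<gamma>]
    by (intro standard_Borel_restrict_space_Int standard_Borel_pair Y standard_Borel_borel)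
  moreover have "space T = (SIGMA y:space Y. \<gamma> y)"
    by (auto simp: T_def space_restrict_space space_pair_measure)
  moreover have "\<exists>d :: 'y \<times> 'u \<Rightarrow> 'y \<times> 'u \<Rightarrow> real.
      (\<lambda>(v, w). d v w) \<in> borel_measurable (restrict_space (T \<Otimes>\<^sub>M T) {(v, w). fst v = fst w}) \<and>
      (\<forall>y\<in>space Y. let S = \<gamma> y; dx = (\<lambda>v w. d (y, v) (y, w)) in
         Metric_space S dx \<and> Metric_space.mcomplete S dx \<and>
         separable_space (Metric_space.mtopology S dx) \<and> Metric_space.mtopology S dx = top_of_set S)"
  proof (intro exI conjI ballI)
    note [measurable] = snd_T
    have "(\<lambda>p. dist (snd (fst p)) (snd (snd p))) \<in> borel_measurable (T \<Otimes>\<^sub>M T)"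
      by measurable
    then show "(\<lambda>(v, w). dist (snd v) (snd w)) \<in> borel_measurable (restrict_space (T \<Otimes>\<^sub>M T) {(v, w). fst v = fst w})"
      by (intro measurable_restrict_space1) (simp add: case_prod_beta)
    fix y
    assume y: "y \<in> space Y"
    interpret Submetric UNIV dist "\<gamma> y"
      by unfold_locales auto
    have "sub.mcomplete"
      using closed[OF y] closedin_mcomplete_imp_mcomplete
      by (simp add: complete_UNIV)
    moreover have "sub.mtopology = top_of_set (\<gamma> y)"
      by (simp add: mtopology_submetric)
    moreover have "separable_space (top_of_set (\<gamma> y))"
      using Polish_space_closed_subset[OF closed[OF y]] by (simp add: Polish_space_def)
    ultimately show "let S = \<gamma> y; dx = (\<lambda>v w. dist (snd (y, v)) (snd (y, w))) in
         Metric_space S dx \<and> Metric_space.mcomplete S dx \<and>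
         separable_space (Metric_space.mtopology S dx) \<and> Metric_space.mtopology S dx = top_of_set S"
      by (simp add: sub.Metric_space_axioms)
  qed
  moreover have "\<exists>\<phi> :: nat \<Rightarrow> 'y \<Rightarrow> 'y \<times> 'u.
      (\<forall>n. \<phi> n \<in> measurable Y T) \<and> (\<forall>n. \<forall>y\<in>space Y. fst (\<phi> n y) = y) \<and>
      (\<forall>y\<in>space Y. top_of_set (\<gamma> y) closure_of range (\<lambda>n. snd (\<phi> n y)) = \<gamma> y)"
  proof -
    obtain \<sigma> :: "nat \<Rightarrow> 'u set \<Rightarrow> 'u" where \<sigma>: "\<forall>n. \<sigma> n \<in> borel_measurable Effros"
      "\<forall>K\<in>space Effros. closure (range (\<lambda>n. \<sigma> n K)) = K"
      using Effros_dense_selectors .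
    have dense: "closure (range (\<lambda>n. \<sigma> n (\<gamma> y))) = \<gamma> y" if "y \<in> space Y" for y
      using \<sigma>(2) measurable_space[OF \<gamma> that] by blast
    then have in_\<gamma>: "\<sigma> n (\<gamma> y) \<in> \<gamma> y" if "y \<in> space Y" for n y
      by (subst (2) dense[OF that, symmetric]) (rule subsetD[OF closure_subset], simp)
    have "(\<lambda>y. (y, \<sigma> n (\<gamma> y))) \<in> measurable Y T" for n
      unfolding T_def using \<sigma>(1) \<gamma> in_\<gamma>
      by (intro measurable_restrict_space2 measurable_Pair measurable_compose[OF \<gamma>]) auto
    moreover have "top_of_set (\<gamma> y) closure_of range (\<lambda>n. \<sigma> n (\<gamma> y)) = \<gamma> y" if "y \<in> space Y" for y
      using dense[OF that] in_\<gamma>[OF that]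
      by (simp add: closure_of_subtopology Int_absorb1 image_subset_iff)
    ultimately show ?thesis
      by (intro exI[of _ "\<lambda>n y. (y, \<sigma> n (\<gamma> y))"]) simp
  qed
  ultimately show ?thesis
    unfolding Borel_field_def V using Y fst_T closed
    by (simp add: Polish_space_closed_subset)
qed

lemma Borel_field_restrict_field:
  assumes V: "Borel_field V" and X0: "X0 \<in> sets (base V)"
  shows "Borel_field (restrict_field V X0)"
proof -
  define X where "X = base V"
  define T where "T = total V"
  define E where "E = {v :: 'a \<times> 'b. fst v \<in> X0}"
  have sub: "X0 \<subseteq> space X"
    using X0 by (simp add: X_def sets.sets_into_space)
  have restr: "base (restrict_field V X0) = restrict_space X X0" "fibre (restrict_field V X0) = fibre V"
    "total (restrict_field V X0) = restrict_space T E"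
    by (simp_all add: restrict_field_def X_def T_def E_def)
  have fst_T: "fst \<in> measurable T X" and space_T: "space T = (SIGMA x:space X. topspace (fibre V x))"
    and std: "standard_Borel X" "standard_Borel T"
    and polish: "\<forall>x\<in>space X. Polish_space (fibre V x)"
    using V unfolding Borel_field_def X_def T_def by blast+
  obtain d where d: "(\<lambda>(v, w). d v w) \<in> borel_measurable (restrict_space (T \<Otimes>\<^sub>M T) {(v, w). fst v = fst w})"
    "\<forall>x\<in>space X. let S = topspace (fibre V x); dx = (\<lambda>v w. d (x, v) (x, w)) in
             Metric_space S dx \<and> Metric_space.mcomplete S dx \<and>
             separable_space (Metric_space.mtopology S dx) \<and>
             Metric_space.mtopology S dx = fibre V x"
    using V unfolding Borel_field_def X_def T_def by blast
  obtain \<phi> where \<phi>: "\<forall>n :: nat. \<phi> n \<in> measurable X T" "\<forall>n. \<forall>x\<in>space X. fst (\<phi> n x) = x"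
    "\<forall>x\<in>space X. fibre V x closure_of (range (\<lambda>n. snd (\<phi> n x))) = topspace (fibre V x)"
    using V unfolding Borel_field_def X_def T_def by blast
  have E: "E \<inter> space T \<in> sets T"
    using measurable_sets[OF fst_T, of X0] X0 by (simp add: E_def X_def vimage_def)
  have "standard_Borel (restrict_space X X0)"
    using std(1) X0 by (simp add: standard_Borel_restrict_space X_def)
  moreover have "standard_Borel (restrict_space T E)"
    using std(2) E by (rule standard_Borel_restrict_space_Int)
  moreover have "space (restrict_space T E) = (SIGMA x:space (restrict_space X X0). topspace (fibre V x))"
    by (auto simp: space_restrict_space space_T E_def)
  moreover have "fst \<in> measurable (restrict_space T E) (restrict_space X X0)"
    using fst_T by (rule measurable_restrict_space3) (auto simp: E_def)
  moreover have "(\<lambda>(v, w). d v w) \<in> borel_measurable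
      (restrict_space (restrict_space T E \<Otimes>\<^sub>M restrict_space T E) {(v, w). fst v = fst w})"
  proof -
    have id: "(\<lambda>v. v) \<in> measurable (restrict_space T E) T"
      by (rule measurable_restrict_space1) simp
    have "(\<lambda>p. (fst p, snd p)) \<in> measurable (restrict_space T E \<Otimes>\<^sub>M restrict_space T E) (T \<Otimes>\<^sub>M T)"
      by (intro measurable_Pair measurable_compose[OF measurable_fst id] measurable_compose[OF measurable_snd id])
    then have "(\<lambda>p. p) \<in> measurable (restrict_space (restrict_space T E \<Otimes>\<^sub>M restrict_space T E) {(v, w). fst v = fst w})
        (restrict_space (T \<Otimes>\<^sub>M T) {(v, w). fst v = fst w})"
      by (intro measurable_restrict_space3) auto
    from measurable_compose[OF this d(1)] show ?thesis .
  qed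
  moreover have "\<phi> n \<in> measurable (restrict_space X X0) (restrict_space T E)" for n
    using \<phi>(1,2) sub
    by (intro measurable_restrict_space2 measurable_restrict_space1) (auto simp: E_def space_restrict_space)
  ultimately show ?thesis
    unfolding Borel_field_def restr using polish d(2) \<phi>(2,3)
    by (intro conjI exI[of _ d] exI[of _ \<phi>]) (auto simp: space_restrict_space)
qed

text \<open>Bijectivity on the total spaces is automatic: \<open>\<psi>\<close> matches the base
  points, and the homeomorphisms match the points over them.\<close>

lemma isomorphic_Borel_fieldsI:
  assumes W: "Borel_field W" and V: "Borel_field V"
    and \<psi>: "\<psi> \<in> measurable (base W) (base V)" "bij_betw \<psi> (space (base W)) (space (base V))"
    and \<theta>: "(\<lambda>p. (\<psi> (fst p), F p)) \<in> measurable (total W) (total V)"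
    and hom: "\<And>y. y \<in> space (base W) \<Longrightarrow> homeomorphic_map (fibre W y) (fibre V (\<psi> y)) (\<lambda>w. F (y, w))"
  shows "isomorphic_Borel_fields W V"
proof -
  have space_W: "space (total W) = (SIGMA y:space (base W). topspace (fibre W y))"
    and space_V: "space (total V) = (SIGMA x:space (base V). topspace (fibre V x))"
    using W V unfolding Borel_field_def by blast+
  have inj: "inj_on (\<lambda>w. F (y, w)) (topspace (fibre W y))"
    and img: "(\<lambda>w. F (y, w)) ` topspace (fibre W y) = topspace (fibre V (\<psi> y))"
    if "y \<in> space (base W)" for y
    using hom[OF that] homeomorphic_imp_injective_map homeomorphic_imp_surjective_map by blast+
  have "inj_on (\<lambda>p. (\<psi> (fst p), F p)) (space (total W))"
  proof (rule inj_onI)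
    fix p q
    assume p: "p \<in> space (total W)" and q: "q \<in> space (total W)"
      and eq: "(\<psi> (fst p), F p) = (\<psi> (fst q), F q)"
    then have "fst p = fst q"
      using \<psi>(2) by (auto simp: space_W bij_betw_def dest: inj_onD)
    then show "p = q"
      using p q eq inj[of "fst p"] by (auto simp: space_W dest: inj_onD)
  qed
  moreover have "(\<lambda>p. (\<psi> (fst p), F p)) ` space (total W) = space (total V)"
  proof
    show "(\<lambda>p. (\<psi> (fst p), F p)) ` space (total W) \<subseteq> space (total V)"
      using measurable_space[OF \<theta>] by blast
    show "space (total V) \<subseteq> (\<lambda>p. (\<psi> (fst p), F p)) ` space (total W)"
    proof
      fix q
      assume "q \<in> space (total V)"
      then obtain x u where q: "q = (x, u)" "x \<in> space (base V)" "u \<in> topspace (fibre V x)"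
        by (auto simp: space_V)
      obtain y where y: "y \<in> space (base W)" "x = \<psi> y"
        using \<psi>(2) q(2) by (auto simp: bij_betw_def)
      obtain w where "w \<in> topspace (fibre W y)" "u = F (y, w)"
        using img[OF y(1)] q(3) y(2) by blast
      then show "q \<in> (\<lambda>p. (\<psi> (fst p), F p)) ` space (total W)"
        using q(1) y by (intro image_eqI[of _ _ "(y, w)"]) (auto simp: space_W)
    qed
  qed
  ultimately have "bij_betw (\<lambda>p. (\<psi> (fst p), F p)) (space (total W)) (space (total V))"
    by (simp add: bij_betw_def)
  then show ?thesis
    unfolding isomorphic_Borel_fields_def using W V \<psi> \<theta> hom
    by (intro conjI exI[of _ \<psi>] exI[of _ "\<lambda>p. (\<psi> (fst p), F p)"]) auto
qed

text \<open>Kept apart from any map of base spaces, since the same \<open>F\<close> and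
  \<open>\<gamma>\<close> serve both the identity of the base and the map
  \<open>y \<mapsto> (i y, \<gamma> y)\<close> into the universal field.\<close>

lemma Borel_field_closed_coding:
  fixes W :: "('y, 'w) field_of_spaces"
  assumes W: "Borel_field W"
  obtains F :: "'y \<times> 'w \<Rightarrow> nat \<Rightarrow> real" and \<gamma> :: "'y \<Rightarrow> (nat \<Rightarrow> real) set"
  where "F \<in> borel_measurable (total W)" "\<gamma> \<in> measurable (base W) Effros"
    "\<forall>y\<in>space (base W). homeomorphic_map (fibre W y) (top_of_set (\<gamma> y)) (\<lambda>w. F (y, w))"
proof -
  define Y where "Y = base W"
  define T where "T = total W"
  obtain d where d: "(\<lambda>(v, w). d v w) \<in> borel_measurable (restrict_space (T \<Otimes>\<^sub>M T) {(v, w). fst v = fst w})"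
    "\<forall>y\<in>space Y. let S = topspace (fibre W y); dy = (\<lambda>v w. d (y, v) (y, w)) in
             Metric_space S dy \<and> Metric_space.mcomplete S dy \<and>
             separable_space (Metric_space.mtopology S dy) \<and>
             Metric_space.mtopology S dy = fibre W y"
    using W unfolding Borel_field_def Y_def T_def by blast
  obtain \<phi> where \<phi>: "\<forall>n :: nat. \<phi> n \<in> measurable Y T" "\<forall>n. \<forall>y\<in>space Y. fst (\<phi> n y) = y"
    "\<forall>y\<in>space Y. fibre W y closure_of (range (\<lambda>n. snd (\<phi> n y))) = topspace (fibre W y)"
    using W unfolding Borel_field_def Y_def T_def by blast
  have fst_T: "fst \<in> measurable T Y" and space_T: "space T = (SIGMA y:space Y. topspace (fibre W y))"
    using W unfolding Borel_field_def Y_def T_def by blast+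
  define F where "F p = closed_code (\<lambda>n. d p (\<phi> n (fst p)))" for p
  define \<gamma> where "\<gamma> y = (\<lambda>w. F (y, w)) ` topspace (fibre W y)" for y
  have "(\<lambda>p. d p (\<phi> n (fst p))) \<in> borel_measurable T" for n
  proof -
    have "(\<lambda>p. \<phi> n (fst p)) \<in> measurable T T"
      using fst_T \<phi>(1) by (auto intro: measurable_compose)
    \<comment> \<open>The metric is Borel only on pairs over a common base point; \<open>p\<close>
      and the section at \<open>fst p\<close> form such a pair.\<close>
    then have "(\<lambda>p. (p, \<phi> n (fst p))) \<in> measurable T (restrict_space (T \<Otimes>\<^sub>M T) {(v, w). fst v = fst w})"
      using \<phi>(2) measurable_space[OF fst_T] by (intro measurable_restrict_space2) auto
    from measurable_compose[OF this d(1)] show ?thesis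
      by simp
  qed
  then have "(\<lambda>p n. d p (\<phi> n (fst p))) \<in> borel_measurable T"
    by (rule measurable_coordinatewise_then_product)
  then have F: "F \<in> borel_measurable T"
    unfolding F_def[abs_def] by (rule measurable_compose) (rule measurable_closed_code)
  have \<phi>_fibre: "(y, snd (\<phi> n y)) = \<phi> n y" "snd (\<phi> n y) \<in> topspace (fibre W y)"
    if "y \<in> space Y" for n y
  proof -
    have "\<phi> n y \<in> space T"
      using \<phi>(1) that by (auto dest: measurable_space)
    then show "(y, snd (\<phi> n y)) = \<phi> n y" "snd (\<phi> n y) \<in> topspace (fibre W y)"
      using \<phi>(2) that by (auto simp: space_T prod_eq_iff)
  qed
  have fibres: "closed (\<gamma> y)" "homeomorphic_map (fibre W y) (top_of_set (\<gamma> y)) (\<lambda>w. F (y, w))"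
    "\<And>C. closedin (fibre W y) C \<Longrightarrow> closed ((\<lambda>w. F (y, w)) ` C)"
    if y: "y \<in> space Y" for y
  proof -
    define M where "M = topspace (fibre W y)"
    define dy where "dy = (\<lambda>v w. d (y, v) (y, w))"
    define p where "p n = snd (\<phi> n y)" for n
    have met: "Metric_space M dy" "Metric_space.mcomplete M dy" "Metric_space.mtopology M dy = fibre W y"
      using d(2) y unfolding M_def dy_def by (auto simp: Let_def)
    interpret Metric_space M dy
      by fact
    have p: "range p \<subseteq> M" "mtopology closure_of range p = M"
      using \<phi>_fibre(2)[OF y] \<phi>(3) y met(3) by (auto simp: p_def[abs_def] M_def)
    have F_y: "(\<lambda>w. F (y, w)) = (\<lambda>w. closed_code (\<lambda>n. dy w (p n)))"
      using \<phi>_fibre(1)[OF y] by (simp add: F_def dy_def p_def)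
    have \<gamma>_y: "\<gamma> y = (\<lambda>w. closed_code (\<lambda>n. dy w (p n))) ` M"
      unfolding \<gamma>_def F_y M_def ..
    show "homeomorphic_map (fibre W y) (top_of_set (\<gamma> y)) (\<lambda>w. F (y, w))"
      using homeomorphic_map_closed_code[OF met(2) p] unfolding F_y \<gamma>_y met(3) .
    show closed_image: "closed ((\<lambda>w. F (y, w)) ` C)" if "closedin (fibre W y) C" for C
      using closed_image_closed_code[OF met(2) p] that unfolding F_y met(3) .
    show "closed (\<gamma> y)"
      unfolding \<gamma>_def by (intro closed_image) simp
  qed
  have "\<gamma> \<in> measurable Y Effros"
  proof (rule measurable_EffrosI)
    fix y
    assume y: "y \<in> space Y"
    \<comment> \<open>Points of the Effros space are nonempty sets; a section supplies a point of
      each fibre.\<close>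
    then show "closed (\<gamma> y) \<and> \<gamma> y \<noteq> {}"
      using fibres(1)[OF y] \<phi>_fibre(2)[OF y] unfolding \<gamma>_def by blast
  next
    fix G :: "(nat \<Rightarrow> real) set"
    assume "open G"
    \<comment> \<open>By continuity, an open set that meets the image of the fibre meets the image
      of the dense sections, which leaves a countable union.\<close>
    have "\<gamma> y \<inter> G \<noteq> {} \<longleftrightarrow> (\<exists>n. F (\<phi> n y) \<in> G)" if y: "y \<in> space Y" for y
    proof
      assume "\<exists>n. F (\<phi> n y) \<in> G"
      then obtain n where "F (y, snd (\<phi> n y)) \<in> G"
        unfolding \<phi>_fibre(1)[OF y] ..
      then show "\<gamma> y \<inter> G \<noteq> {}"
        using \<phi>_fibre(2)[OF y] unfolding \<gamma>_def by blast
    next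
      assume "\<gamma> y \<inter> G \<noteq> {}"
      then obtain w where w: "w \<in> topspace (fibre W y)" "F (y, w) \<in> G"
        by (auto simp: \<gamma>_def)
      have "continuous_map (fibre W y) euclidean (\<lambda>w. F (y, w))"
        using homeomorphic_imp_continuous_map[OF fibres(2)[OF y]]
        by (simp add: continuous_map_in_subtopology)
      then have "openin (fibre W y) {w \<in> topspace (fibre W y). F (y, w) \<in> G}"
        using \<open>open G\<close> by (simp add: openin_continuous_map_preimage)
      moreover have "w \<in> fibre W y closure_of (range (\<lambda>n. snd (\<phi> n y)))"
        using \<phi>(3) y w(1) by simp
      ultimately obtain v where "v \<in> range (\<lambda>n. snd (\<phi> n y))" "F (y, v) \<in> G"
        using w unfolding in_closure_of by (metis (mono_tags, lifting) mem_Collect_eq)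
      then obtain n where "F (y, snd (\<phi> n y)) \<in> G"
        by blast
      then show "\<exists>n. F (\<phi> n y) \<in> G"
        unfolding \<phi>_fibre(1)[OF y] ..
    qed
    then have "{y \<in> space Y. \<gamma> y \<inter> G \<noteq> {}} = (\<Union>n. (\<lambda>y. F (\<phi> n y)) -` G \<inter> space Y)"
      by auto
    also have "\<dots> \<in> sets Y"
    proof -
      have "(\<lambda>y. F (\<phi> n y)) -` G \<inter> space Y \<in> sets Y" for n
        using measurable_sets[OF measurable_compose[OF _ F, of "\<phi> n" Y], of G] \<phi>(1) \<open>open G\<close> by simp
      then show ?thesis
        by blast
    qed
    finally show "{y \<in> space Y. \<gamma> y \<inter> G \<noteq> {}} \<in> sets Y" .
  qed
  then show ?thesis
    using F fibres(2) by (intro that[of F \<gamma>]) (auto simp: Y_def T_def)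
qed

section \<open>Isomorphism with a field of closed sets, and universality\<close>

lemma Borel_field_isomorphic_closed_sets_field:
  fixes W :: "('y, 'w) field_of_spaces"
  assumes W: "Borel_field W"
  shows "\<exists>\<gamma> :: 'y \<Rightarrow> (nat \<Rightarrow> real) set. \<gamma> \<in> measurable (base W) Effros \<and>
           isomorphic_Borel_fields W (closed_sets_field (base W) \<gamma>)"
proof -
  obtain F and \<gamma> :: "'y \<Rightarrow> (nat \<Rightarrow> real) set" where F: "F \<in> borel_measurable (total W)"
    and \<gamma>: "\<gamma> \<in> measurable (base W) Effros"
    and hom: "\<forall>y\<in>space (base W). homeomorphic_map (fibre W y) (top_of_set (\<gamma> y)) (\<lambda>w. F (y, w))"
    using Borel_field_closed_coding[OF W] .
  have std: "standard_Borel (base W)" and fst: "fst \<in> measurable (total W) (base W)"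
    and space_W: "space (total W) = (SIGMA y:space (base W). topspace (fibre W y))"
    using W unfolding Borel_field_def by blast+
  have in_\<gamma>: "F p \<in> \<gamma> (fst p)" if "p \<in> space (total W)" for p
    using that hom homeomorphic_imp_surjective_map by (fastforce simp: space_W)
  have "isomorphic_Borel_fields W (closed_sets_field (base W) \<gamma>)"
  proof (rule isomorphic_Borel_fieldsI[where \<psi> = "\<lambda>y. y" and F = F])
    show "Borel_field (closed_sets_field (base W) \<gamma>)"
      using std \<gamma> by (rule Borel_field_closed_sets_field)
    show "(\<lambda>p. (fst p, F p)) \<in> measurable (total W) (total (closed_sets_field (base W) \<gamma>))"
      unfolding closed_sets_field_def using fst F in_\<gamma>
      by (auto intro!: measurable_restrict_space2 measurable_Pair)
  qed (use W hom in \<open>auto simp: closed_sets_field_def bij_betw_def\<close>)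
  with \<gamma> show ?thesis
    by blast
qed

text \<open>
  A field over \<open>Y\<close> is coded by \<open>y \<mapsto> (i y, \<gamma> y)\<close> with \<open>i\<close> a Borel isomorphism onto a Borel subset of
  the unit interval. The range of this map is the graph of the Borel map \<open>\<gamma> \<circ> i\<inverse>\<close>, hence Borel, which
  avoids the Lusin--Souslin theorem on injective Borel images.
\<close>

lemma universal_closed_sets_field:
  "universal_Borel_field TYPE('a) TYPE('b)
     (closed_sets_field
        (restrict_space (borel :: real measure) {0..1} \<Otimes>\<^sub>M (Effros :: (nat \<Rightarrow> real) set measure))
        (\<lambda>(t, P). P))"
proof -
  define X where "X = restrict_space (borel :: real measure) {0..1} \<Otimes>\<^sub>M (Effros :: (nat \<Rightarrow> real) set measure)"
  define V where "V = closed_sets_field X (\<lambda>(t :: real, P :: (nat \<Rightarrow> real) set). P)"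
  have "standard_Borel X"
    unfolding X_def
    by (intro standard_Borel_pair standard_Borel_restrict_space standard_Borel_real standard_Borel_Effros) simp
  moreover have "(\<lambda>(t, P). P) \<in> measurable X Effros"
    unfolding X_def by (simp add: case_prod_beta)
  ultimately have V: "Borel_field V"
    unfolding V_def by (rule Borel_field_closed_sets_field)
  have base_V: "base V = X"
    by (simp add: V_def closed_sets_field_def)
  have "\<exists>X0\<in>sets X. isomorphic_Borel_fields W (restrict_field V X0)"
    if W: "Borel_field W" for W :: "('a, 'b) field_of_spaces"
  proof -
    define Y where "Y = base W"
    obtain F and \<gamma> :: "'a \<Rightarrow> (nat \<Rightarrow> real) set" where F: "F \<in> borel_measurable (total W)"
      and \<gamma>: "\<gamma> \<in> measurable Y Effros"
      and hom: "\<forall>y\<in>space Y. homeomorphic_map (fibre W y) (top_of_set (\<gamma> y)) (\<lambda>w. F (y, w))"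
      using Borel_field_closed_coding[OF W, folded Y_def] .
    have "standard_Borel Y" and fst: "fst \<in> measurable (total W) Y"
      and space_W: "space (total W) = (SIGMA y:space Y. topspace (fibre W y))"
      using W unfolding Borel_field_def Y_def by blast+
    obtain B :: "real set" where B: "B \<in> sets borel" "B \<subseteq> {0..1}" "Borel_isomorphic Y (restrict_space borel B)"
      using standard_Borel_imp_unit_interval[OF \<open>standard_Borel Y\<close>] .
    obtain i j where i: "i \<in> measurable Y (restrict_space borel B)"
      and j: "j \<in> measurable (restrict_space borel B) Y"
      and ji: "\<forall>y\<in>space Y. j (i y) = y" and ij: "\<forall>t\<in>space (restrict_space borel B). i (j t) = t"
      using B(3) unfolding Borel_isomorphic_def by blast
    have i_B: "i y \<in> B" if "y \<in> space Y" for y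
      using measurable_space[OF i that] by (simp add: space_restrict_space)
    define \<psi> where "\<psi> y = (i y, \<gamma> y)" for y
    have "i \<in> measurable Y (restrict_space borel {0..1})"
      using i i_B B(2) by (auto simp: measurable_restrict_space2_iff)
    then have \<psi>: "\<psi> \<in> measurable Y X"
      unfolding \<psi>_def[abs_def] X_def using \<gamma> by (rule measurable_Pair)
    define X0 where "X0 = \<psi> ` space Y"
    have X0: "X0 \<in> sets X"
    proof -
      \<comment> \<open>Over \<open>A\<close> the inverse \<open>j\<close> can be applied to the
        first coordinate.\<close>
      define A where "A = fst -` B \<inter> space X"
      \<comment> \<open>Under \<open>e\<close>, the equation \<open>\<gamma> (j t) = P\<close>
        between closed sets becomes one between reals.\<close>
      obtain e :: "(nat \<Rightarrow> real) set \<Rightarrow> real" where e [measurable]: "e \<in> borel_measurable Effros"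
        and inj_e: "inj_on e (space Effros)"
        using standard_Borel_separated[OF standard_Borel_Effros] .
      have fst_X: "fst \<in> borel_measurable X"
        unfolding X_def by (rule measurable_compose[OF measurable_fst]) (simp add: measurable_restrict_space1)
      then have A: "A \<in> sets X"
        unfolding A_def using B(1) by (rule measurable_sets)
      have "fst \<in> measurable (restrict_space X A) (restrict_space borel B)"
        using fst_X by (rule measurable_restrict_space3) (auto simp: A_def)
      then have [measurable]: "(\<lambda>p. j (fst p)) \<in> measurable (restrict_space X A) Y"
        using j by (rule measurable_compose)
      have [measurable]: "snd \<in> measurable (restrict_space X A) Effros"
        unfolding X_def by (intro measurable_restrict_space1 measurable_snd)
      note [measurable] = \<gamma>
      have "{p \<in> space (restrict_space X A). e (\<gamma> (j (fst p))) = e (snd p)} \<in> sets (restrict_space X A)"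
        by measurable
      then have "{p \<in> space (restrict_space X A). e (\<gamma> (j (fst p))) = e (snd p)} \<in> sets X"
        using A by (auto simp: sets_restrict_space_iff)
      also have "{p \<in> space (restrict_space X A). e (\<gamma> (j (fst p))) = e (snd p)} = X0"
      proof
        show "X0 \<subseteq> {p \<in> space (restrict_space X A). e (\<gamma> (j (fst p))) = e (snd p)}"
          using measurable_space[OF \<psi>] ji i_B
          by (auto simp: X0_def \<psi>_def A_def space_restrict_space)
        show "{p \<in> space (restrict_space X A). e (\<gamma> (j (fst p))) = e (snd p)} \<subseteq> X0"
        proof clarify
          fix t P
          assume "(t, P) \<in> space (restrict_space X A)" and eq: "e (\<gamma> (j (fst (t, P)))) = e (snd (t, P))"
          then have t: "t \<in> space (restrict_space borel B)" and P: "P \<in> space Effros"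
            by (auto simp: A_def X_def space_restrict_space space_pair_measure)
          have "j t \<in> space Y"
            using measurable_space[OF j t] .
          moreover from this have "\<gamma> (j t) = P"
            using eq inj_onD[OF inj_e] P measurable_space[OF \<gamma>] by simp
          ultimately show "(t, P) \<in> X0"
            using ij t by (auto simp: X0_def \<psi>_def intro!: image_eqI[of _ _ "j t"])
        qed
      qed
      finally show ?thesis .
    qed
    have in_\<gamma>: "F p \<in> \<gamma> (fst p)" "fst p \<in> space Y" if "p \<in> space (total W)" for p
      using that hom homeomorphic_imp_surjective_map by (fastforce simp: space_W)+
    have "isomorphic_Borel_fields W (restrict_field V X0)"
    proof (rule isomorphic_Borel_fieldsI[where \<psi> = \<psi> and F = F])
      show "Borel_field (restrict_field V X0)"
        using V X0 by (intro Borel_field_restrict_field) (simp_all add: base_V)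
      show "\<psi> \<in> measurable (base W) (base (restrict_field V X0))"
        using \<psi> by (auto simp: restrict_field_def base_V X0_def simp flip: Y_def intro!: measurable_restrict_space2)
      \<comment> \<open>Different base points may carry the same closed set; the interval coordinate
        \<open>i y\<close> tells them apart.\<close>
      have "inj_on \<psi> (space Y)"
        using ji by (auto simp: \<psi>_def intro!: inj_on_inverseI[where g = "\<lambda>p. j (fst p)"])
      moreover have "X0 \<inter> space X = X0"
        using sets.sets_into_space[OF X0] by blast
      ultimately show "bij_betw \<psi> (space (base W)) (space (base (restrict_field V X0)))"
        by (simp add: bij_betw_def restrict_field_def base_V space_restrict_space X0_def flip: Y_def)
      have "(\<lambda>p. \<psi> (fst p)) \<in> measurable (total W) X"
        using fst \<psi> by (rule measurable_compose)
      then have "(\<lambda>p. (\<psi> (fst p), F p)) \<in> measurable (total W) (X \<Otimes>\<^sub>M borel)"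
        using F by (rule measurable_Pair)
      then show "(\<lambda>p. (\<psi> (fst p), F p)) \<in> measurable (total W) (total (restrict_field V X0))"
        unfolding restrict_field_def V_def closed_sets_field_def using in_\<gamma>
        by (auto simp: \<psi>_def X0_def intro!: measurable_restrict_space2)
    qed (use W hom in \<open>auto simp: restrict_field_def V_def closed_sets_field_def \<psi>_def simp flip: Y_def\<close>)
    then show ?thesis
      using X0 by blast
  qed
  with V show ?thesis
    unfolding universal_Borel_field_def by (simp add: V_def X_def closed_sets_field_def)
qed

theorem proposition12p2:
  shows
    "(\<forall>W :: ('y, 'w) field_of_spaces. Borel_field W \<longrightarrow>
        (\<exists>\<gamma> :: 'y \<Rightarrow> (nat \<Rightarrow> real) set.
           \<gamma> \<in> measurable (base W) Effros \<and>
           isomorphic_Borel_fields W (closed_sets_field (base W) \<gamma>))) \<and>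
     universal_Borel_field TYPE('a) TYPE('b)
       (closed_sets_field
          (restrict_space (borel :: real measure) {0..1} \<Otimes>\<^sub>M (Effros :: (nat \<Rightarrow> real) set measure))
          (\<lambda>(t, P). P))"
  using Borel_field_isomorphic_closed_sets_field universal_closed_sets_field by blast

end
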